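(* Let $D=\mathbb{R}^k$, let $f\in BC_\mu^{1-}([0,T]\times S\times\mathbb{R}^k,\mathbb{R}^k)$, and let $g\in B_b(S,\mathbb{R}^k)$ be consistent. Let $u_g$ be the unique non-extendible admissible solution to (M) and $I_g$ its maximal interval of existence. Assume that $f$ is affine $\mu$-bounded. Then $I_g=[0,T]$ and the sequence $(u_n)_{n\in\mathbb{N}_0}$ in $B_b([0,T]\times S,\mathbb{R}^k)$, defined recursively by $u_0(r,x):=E_{r,x}[g(X_T)]$ and $$u_n(r,x):=u_0(r,x)-E_{r,x}\bigg[\int_r^Tf(s,X_s,u_{n-1}(s,X_s))\,\mu(ds)\bigg]$$ for all $n\in\mathbb{N}$, converges uniformly to $u_g$, the unique global bounded solution to (M).
   Context: **Spaces.** $S$ is a separable metrizable topological space, $T>0$, $\mu$ is an atomless Borel measure on $[0,T]$, $k\in\mathbb{N}$, $|\cdot|$ is the Euclidean norm. $[0,T]\times S$ carries a pseudometric $d_S$ whose topology is coarser than or equal to the product topology; $\mathcal{B}(I\times S)$ and Borel measurability on $I\times S$ ($I\subset[0,T]$ an interval) refer to $d_S$. A map $u$ on $I\times S$ is consistent if $u(r,x)=u(s,y)$ whenever $d_S((r,x),(s,y))=0$. A map $g$ on $S$ is consistent if $g(x)=g(y)$ whenever $d_S((T,x),(T,y))=0$. $B(S,D)$, $B(I\times S,D)$ are the sets of $D$-valued Borel measurable maps; $B_b$ denotes the bounded ones. **Markov process.** $\mathcal{X}=(X,(\mathcal{F}_t)_{t\in[0,T]},\mathbb{P})$ is a fixed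 consistent progressive Markov process on a measurable space $(\Omega,\mathcal{F})$ with state space $S$ and Borel measurable transition probabilities: $X:[0,T]\times\Omega\to S$ is a process adapted to the filtration $(\mathcal{F}_t)$, $\mathbb{P}=\{P_{r,x}\mid(r,x)\in[0,T]\times S\}$ is a set of probability measures on $(\Omega,\mathcal{F})$ (expectations $E_{r,x}$), and: (1) for each $(s,y)$, $P_{s,y}$-a.s. $d_S((r,X_r),(r,y))=0$ for all $r\in[0,s]$; (2) $[0,t]\times S\to[0,1]$, $(s,x)\mapsto P_{s,x}(X_t\in B)$ is consistent and Borel measurable for all $t\in[0,T]$, $B\in\mathcal{B}(S)$; (3) $P_{r,x}(X_t\in B\mid\mathcal{F}_s)=P_{s,X_s}(X_t\in B)$ $P_{r,x}$-a.s. for all $r\le s\le t$, $x\in S$, $B\in\mathcal{B}(S)$; (4) $X$ is progressively measurable with respect to its natural filtration and its natural backward filtration. **Regularity with respect to $\mu$.** $a\in B([0,T]\times S,\mathbb{R}_+)$ is $\mu$-dominated if there is a $\mu$-integrable $\overline a\in B([0,T],\mathbb{R}_+)$ such that, outside a $\mu$-null set of $s$, $a(s,y)\le\overline a(s)$ for all $y\in S$. A $\mathcal{B}([0,T]\times S)\otimes\mathcal{B}(D)$-measurable $f:[0,T]\times S\times D\to\mathbb{R}^k$ is: affine $\mu$-bounded if $|f(t,x,w)|\le a(t,x)+b(t,x)|w|$ for all $(t,x,w)$ and some $\mu$-dominated $a,b\in B([0,T]\times S,\mathbb{R}_+)$; locally $\mu$-bounded (resp. locally Lipschitz $\mu$-continuous)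 if each $\hat w\in D$ has a neighborhood $W$ in $\overline D$ and a $\mu$-dominated $\lambda\in B([0,T]\times S,\mathbb{R}_+)$ such that $|f(t,x,w)|\le\lambda(t,x)$ (resp. $|f(t,x,w)-f(t,x,w')|\le\lambda(t,x)|w-w'|$) for all $(t,x)\in[0,T]\times S$ and $w,w'\in W\cap D$. $BC_\mu^{1-}([0,T]\times S\times D,\mathbb{R}^k)$ is the set of all $\mathcal{B}([0,T]\times S)\otimes\mathcal{B}(D)$-measurable maps that are locally $\mu$-bounded and locally Lipschitz $\mu$-continuous. **Problem (M).** An interval $I$ is admissible if $I=(t,T]$ or $I=[t,T]$ for some $t\in[0,T)$. A solution to (M) (with data $f,g$) on an admissible interval $I$ is a consistent $u\in B(I\times S,D)$ such that for all $r\le t$ in $I$ and $x\in S$, $|u(t,X_t)|$ and $\int_r^t|f(s,X_s,u(s,X_s))|\,\mu(ds)$ are finite and $P_{r,x}$-integrable, $E_{r,x}[u(t,X_t)]=u(r,x)+E_{r,x}[\int_r^tf(s,X_s,u(s,X_s))\,\mu(ds)]$, and $u(T,x)=g(x)$. It is global if $I=[0,T]$. A solution $u$ on $I$ is admissible if $u([r,T]\times S)$ is relatively compact in $D^\circ$ (its closure is a compact subset of $D^\circ$) for all $r\in I$. An admissible solution $u$ on $I$ is extendible if there is an admissible solution $\tilde u$ on an admissible interval $\tilde I\supsetneq I$ with $u=\tilde u$ on $I\times S$; otherwise it is non-extendible and $I$ is a maximal interval of existence. For $D=\mathbb{R}^k$, $f\in BC_\mu^{1-}$ and $g$ bounded and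 consistent, there is a unique non-extendible admissible solution; it is denoted $u_g$ and its interval $I_g$.
   Formalization: The formal theorem additionally assumes that the time coordinate (r,x) ↦ r is Borel measurable on [0,T]×S with respect to d_S; without it the claim fails, e.g. for S a point, f=1, g=0, Lebesgue μ on [0,1] and d_S=|max(r,1/2)−max(s,1/2)|, where I_g=[1/2,1]. *)

theory Defs
  imports "HOL-Probability.Probability"
begin

section \<open>The pseudometric on time and state\<close>

definition pm_openin :: "('p \<Rightarrow> 'p \<Rightarrow> real) \<Rightarrow> 'p set \<Rightarrow> 'p set \<Rightarrow> bool" where
  "pm_openin d A U \<longleftrightarrow> U \<subseteq> A \<and> (\<forall>p\<in>U. \<exists>e>0. \<forall>q\<in>A. d p q < e \<longrightarrow> q \<in> U)"

definition pm_borel :: "('p \<Rightarrow> 'p \<Rightarrow> real) \<Rightarrow> 'p set \<Rightarrow> 'p measure" where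
  "pm_borel d A = sigma A {U. pm_openin d A U}"

text \<open>The condition \<open>time_measurable\<close> says that the \<open>d\<close>-Borel sets of \<open>[0,T] \<times> S\<close> see the time
  coordinate, i.e. \<open>[0,t] \<times> S\<close> is \<open>d\<close>-Borel for each \<open>t\<close>. It does not follow from the other
  conditions, and results on the integral equation below need it: if \<open>d = 0\<close>, then only
  constant maps are Borel, so for \<open>S\<close> a single point, \<open>f = 1\<close> and Lebesgue measure \<open>mu\<close>
  there is no solution at all. It holds if \<open>d (r, x) (s, y)\<close> dominates
  \<open>\<bar>r - s\<bar>\<close> up to a modulus, as for the usual choices of \<open>d\<close> (product metrics;
  \<open>\<bar>r - s\<bar>\<close> plus the distance of stopped paths).\<close>

locale time_state_pseudometric =
  fixes T :: real and d :: "real \<times> 's::topological_space \<Rightarrow> real \<times> 's \<Rightarrow> real"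
  assumes nonneg: "\<And>p q. p \<in> {0..T} \<times> UNIV \<Longrightarrow> q \<in> {0..T} \<times> UNIV \<Longrightarrow> 0 \<le> d p q"
    and refl: "\<And>p. p \<in> {0..T} \<times> UNIV \<Longrightarrow> d p p = 0"
    and sym: "\<And>p q. p \<in> {0..T} \<times> UNIV \<Longrightarrow> q \<in> {0..T} \<times> UNIV \<Longrightarrow> d p q = d q p"
    and triangle: "\<And>p q z. p \<in> {0..T} \<times> UNIV \<Longrightarrow> q \<in> {0..T} \<times> UNIV \<Longrightarrow> z \<in> {0..T} \<times> UNIV
      \<Longrightarrow> d p z \<le> d p q + d q z"
    and coarser: "\<And>U. pm_openin d ({0..T} \<times> UNIV) U \<Longrightarrow> openin (top_of_set ({0..T} \<times> UNIV)) U"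
    and time_measurable: "fst \<in> borel_measurable (pm_borel d ({0..T} \<times> UNIV))"

definition consistent_on ::
    "(real \<times> 's \<Rightarrow> real \<times> 's \<Rightarrow> real) \<Rightarrow> real set \<Rightarrow> (real \<Rightarrow> 's \<Rightarrow> 'b) \<Rightarrow> bool" where
  "consistent_on d I u \<longleftrightarrow> (\<forall>r\<in>I. \<forall>s\<in>I. \<forall>x y. d (r, x) (s, y) = 0 \<longrightarrow> u r x = u s y)"

definition consistent_terminal ::
    "real \<Rightarrow> (real \<times> 's \<Rightarrow> real \<times> 's \<Rightarrow> real) \<Rightarrow> ('s \<Rightarrow> 'b) \<Rightarrow> bool" where
  "consistent_terminal T d g \<longleftrightarrow> (\<forall>x y. d (T, x) (T, y) = 0 \<longrightarrow> g x = g y)"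

text \<open>\<open>u \<in> B(I \<times> S, D)\<close>; only the values of \<open>u\<close> on \<open>I \<times> S\<close> matter.\<close>

definition borel_on :: "(real \<times> 's \<Rightarrow> real \<times> 's \<Rightarrow> real) \<Rightarrow> real set \<Rightarrow> 'b::topological_space set
    \<Rightarrow> (real \<Rightarrow> 's \<Rightarrow> 'b) \<Rightarrow> bool" where
  "borel_on d I D u \<longleftrightarrow>
     (\<lambda>(r, x). u r x) \<in> pm_borel d (I \<times> UNIV) \<rightarrow>\<^sub>M restrict_space borel D"

definition bounded_on :: "real set \<Rightarrow> (real \<Rightarrow> 's \<Rightarrow> 'b::metric_space) \<Rightarrow> bool" where
  "bounded_on I u \<longleftrightarrow> bounded ((\<lambda>(r, x). u r x) ` (I \<times> UNIV))"

section \<open>Consistent progressive Markov processes\<close>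

definition natural_sigma :: "'w measure \<Rightarrow> (real \<Rightarrow> 'w \<Rightarrow> 's::topological_space) \<Rightarrow> real set \<Rightarrow> 'w measure"
  where "natural_sigma M X J = sigma (space M) {X s -` B \<inter> space M | s B. s \<in> J \<and> B \<in> sets borel}"

text \<open>Only the measurable space underlying \<open>M\<close> is used; its measure is irrelevant.\<close>

locale consistent_progressive_markov =
  fixes T :: real and d :: "real \<times> 's::topological_space \<Rightarrow> real \<times> 's \<Rightarrow> real"
    and M :: "'w measure" and X :: "real \<Rightarrow> 'w \<Rightarrow> 's" and F :: "real \<Rightarrow> 'w measure"
    and P :: "real \<Rightarrow> 's \<Rightarrow> 'w measure"
  assumes filtration_sub: "\<And>t. t \<in> {0..T} \<Longrightarrow> subalgebra M (F t)"
    and filtration_mono: "\<And>s t. 0 \<le> s \<Longrightarrow> s \<le> t \<Longrightarrow> t \<le> T \<Longrightarrow> sets (F s) \<subseteq> sets (F t)"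
    and adapted: "\<And>t. t \<in> {0..T} \<Longrightarrow> X t \<in> F t \<rightarrow>\<^sub>M borel"
    and prob: "\<And>r x. r \<in> {0..T} \<Longrightarrow> prob_space (P r x)"
    and sets_P: "\<And>r x. r \<in> {0..T} \<Longrightarrow> sets (P r x) = sets M"
    and start: "\<And>s y. s \<in> {0..T} \<Longrightarrow> AE \<omega> in P s y. \<forall>r\<in>{0..s}. d (r, X r \<omega>) (r, y) = 0"
    and transition_consistent: "\<And>t B. t \<in> {0..T} \<Longrightarrow> B \<in> sets borel \<Longrightarrow>
      consistent_on d {0..t} (\<lambda>s x. measure (P s x) {\<omega> \<in> space M. X t \<omega> \<in> B})"
    and transition_borel: "\<And>t B. t \<in> {0..T} \<Longrightarrow> B \<in> sets borel \<Longrightarrow>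
      borel_on d {0..t} {0..1} (\<lambda>s x. measure (P s x) {\<omega> \<in> space M. X t \<omega> \<in> B})"
    and markov: "\<And>r s t x B. 0 \<le> r \<Longrightarrow> r \<le> s \<Longrightarrow> s \<le> t \<Longrightarrow> t \<le> T \<Longrightarrow> B \<in> sets borel \<Longrightarrow>
      AE \<omega> in P r x. real_cond_exp (P r x) (F s) (\<lambda>\<omega>'. indicator B (X t \<omega>')) \<omega>
        = measure (P s (X s \<omega>)) {\<omega>' \<in> space M. X t \<omega>' \<in> B}"
    and progressive: "\<And>t. t \<in> {0..T} \<Longrightarrow>
      (\<lambda>(s, \<omega>). X s \<omega>) \<in> restrict_space borel {0..t} \<Otimes>\<^sub>M natural_sigma M X {0..t} \<rightarrow>\<^sub>M borel"
    and backward_progressive: "\<And>t. t \<in> {0..T} \<Longrightarrow>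
      (\<lambda>(s, \<omega>). X s \<omega>) \<in> restrict_space borel {t..T} \<Otimes>\<^sub>M natural_sigma M X {t..T} \<rightarrow>\<^sub>M borel"

section \<open>Regularity with respect to \<open>mu\<close>\<close>

definition atomless :: "'a measure \<Rightarrow> bool" where
  "atomless mu \<longleftrightarrow> (\<forall>A\<in>sets mu. 0 < emeasure mu A \<longrightarrow>
     (\<exists>B\<in>sets mu. B \<subseteq> A \<and> 0 < emeasure mu B \<and> emeasure mu B < emeasure mu A))"

definition mu_dominated :: "real \<Rightarrow> real measure \<Rightarrow> (real \<times> 's \<Rightarrow> real \<times> 's \<Rightarrow> real)
    \<Rightarrow> (real \<Rightarrow> 's \<Rightarrow> real) \<Rightarrow> bool" where
  "mu_dominated T mu d a \<longleftrightarrow> borel_on d {0..T} {0..} a \<and>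
     (\<exists>abar. integrable mu abar \<and> (\<forall>s\<in>{0..T}. 0 \<le> abar s) \<and>
        (AE s in mu. \<forall>y. a s y \<le> abar s))"

definition jointly_borel :: "real \<Rightarrow> (real \<times> 's \<Rightarrow> real \<times> 's \<Rightarrow> real)
    \<Rightarrow> 'v::euclidean_space set \<Rightarrow> (real \<Rightarrow> 's \<Rightarrow> 'v \<Rightarrow> 'v) \<Rightarrow> bool" where
  "jointly_borel T d D f \<longleftrightarrow> (\<lambda>((t, x), w). f t x w)
     \<in> pm_borel d ({0..T} \<times> UNIV) \<Otimes>\<^sub>M restrict_space borel D \<rightarrow>\<^sub>M borel"

definition affine_mu_bounded :: "real \<Rightarrow> real measure \<Rightarrow> (real \<times> 's \<Rightarrow> real \<times> 's \<Rightarrow> real)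
    \<Rightarrow> 'v::euclidean_space set \<Rightarrow> (real \<Rightarrow> 's \<Rightarrow> 'v \<Rightarrow> 'v) \<Rightarrow> bool" where
  "affine_mu_bounded T mu d D f \<longleftrightarrow>
     (\<exists>a b. mu_dominated T mu d a \<and> mu_dominated T mu d b \<and>
        (\<forall>t\<in>{0..T}. \<forall>x. \<forall>w\<in>D. norm (f t x w) \<le> a t x + b t x * norm w))"

definition nbhd_in :: "'v::topological_space set \<Rightarrow> 'v \<Rightarrow> 'v set \<Rightarrow> bool" where
  "nbhd_in C w W \<longleftrightarrow> W \<subseteq> C \<and> (\<exists>U. openin (top_of_set C) U \<and> w \<in> U \<and> U \<subseteq> W)"

definition locally_mu_bounded :: "real \<Rightarrow> real measure \<Rightarrow> (real \<times> 's \<Rightarrow> real \<times> 's \<Rightarrow> real)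
    \<Rightarrow> 'v::euclidean_space set \<Rightarrow> (real \<Rightarrow> 's \<Rightarrow> 'v \<Rightarrow> 'v) \<Rightarrow> bool" where
  "locally_mu_bounded T mu d D f \<longleftrightarrow>
     (\<forall>w0\<in>D. \<exists>W l. nbhd_in (closure D) w0 W \<and> mu_dominated T mu d l \<and>
        (\<forall>t\<in>{0..T}. \<forall>x. \<forall>w\<in>W \<inter> D. norm (f t x w) \<le> l t x))"

definition locally_Lipschitz_mu_continuous ::
    "real \<Rightarrow> real measure \<Rightarrow> (real \<times> 's \<Rightarrow> real \<times> 's \<Rightarrow> real)
    \<Rightarrow> 'v::euclidean_space set \<Rightarrow> (real \<Rightarrow> 's \<Rightarrow> 'v \<Rightarrow> 'v) \<Rightarrow> bool" where
  "locally_Lipschitz_mu_continuous T mu d D f \<longleftrightarrow>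
     (\<forall>w0\<in>D. \<exists>W l. nbhd_in (closure D) w0 W \<and> mu_dominated T mu d l \<and>
        (\<forall>t\<in>{0..T}. \<forall>x. \<forall>w\<in>W \<inter> D. \<forall>w'\<in>W \<inter> D.
           norm (f t x w - f t x w') \<le> l t x * norm (w - w')))"

text \<open>The class \<open>BC\<^sub>\<mu>\<^sup>1\<^sup>-([0,T] \<times> S \<times> D, \<real>\<^sup>k)\<close>.\<close>

definition BC1minus :: "real \<Rightarrow> real measure \<Rightarrow> (real \<times> 's \<Rightarrow> real \<times> 's \<Rightarrow> real)
    \<Rightarrow> 'v::euclidean_space set \<Rightarrow> (real \<Rightarrow> 's \<Rightarrow> 'v \<Rightarrow> 'v) set" where
  "BC1minus T mu d D = {f. jointly_borel T d D f \<and> locally_mu_bounded T mu d D f \<and>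
     locally_Lipschitz_mu_continuous T mu d D f}"

section \<open>The Markovian integral equation\<close>

definition admissible_interval :: "real \<Rightarrow> real set \<Rightarrow> bool" where
  "admissible_interval T I \<longleftrightarrow> (\<exists>t. 0 \<le> t \<and> t < T \<and> (I = {t<..T} \<or> I = {t..T}))"

definition solution :: "real \<Rightarrow> real measure \<Rightarrow> (real \<times> 's \<Rightarrow> real \<times> 's \<Rightarrow> real) \<Rightarrow> 'w measure
    \<Rightarrow> (real \<Rightarrow> 'w \<Rightarrow> 's) \<Rightarrow> (real \<Rightarrow> 's \<Rightarrow> 'w measure) \<Rightarrow> 'v::euclidean_space set
    \<Rightarrow> (real \<Rightarrow> 's \<Rightarrow> 'v \<Rightarrow> 'v) \<Rightarrow> ('s \<Rightarrow> 'v) \<Rightarrow> real set \<Rightarrow> (real \<Rightarrow> 's \<Rightarrow> 'v) \<Rightarrow> bool" where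
  "solution T mu d M X P D f g I u \<longleftrightarrow>
     admissible_interval T I \<and> borel_on d I D u \<and> consistent_on d I u \<and>
     (\<forall>r\<in>I. \<forall>t\<in>I. \<forall>x. r \<le> t \<longrightarrow>
        integrable (P r x) (\<lambda>\<omega>. norm (u t (X t \<omega>))) \<and>
        (\<forall>\<omega>\<in>space M. set_integrable mu {r..t} (\<lambda>s. f s (X s \<omega>) (u s (X s \<omega>)))) \<and>
        integrable (P r x) (\<lambda>\<omega>. LINT s:{r..t}|mu. norm (f s (X s \<omega>) (u s (X s \<omega>)))) \<and>
        (LINT \<omega>|P r x. u t (X t \<omega>))
          = u r x + (LINT \<omega>|P r x. (LINT s:{r..t}|mu. f s (X s \<omega>) (u s (X s \<omega>))))) \<and>
     (\<forall>x. u T x = g x)"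

definition admissible_solution where
  "admissible_solution T mu d M X P D f g I u \<longleftrightarrow>
     solution T mu d M X P D f g I u \<and>
     (\<forall>r\<in>I. let V = (\<lambda>(s, x). u s x) ` ({r..T} \<times> UNIV)
       in compact (closure V) \<and> closure V \<subseteq> interior D)"

definition extendible where
  "extendible T mu d M X P D f g I u \<longleftrightarrow>
     (\<exists>J v. I \<subset> J \<and> admissible_solution T mu d M X P D f g J v \<and>
        (\<forall>r\<in>I. \<forall>x. v r x = u r x))"

definition nonextendible_solution where
  "nonextendible_solution T mu d M X P D f g I u \<longleftrightarrow>
     admissible_solution T mu d M X P D f g I u \<and> \<not> extendible T mu d M X P D f g I u"

definition unique_nonextendible_solution where
  "unique_nonextendible_solution T mu d M X P D f g I u \<longleftrightarrow>
     nonextendible_solution T mu d M X P D f g I u \<and>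
     (\<forall>J v. nonextendible_solution T mu d M X P D f g J v \<longrightarrow>
        J = I \<and> (\<forall>r\<in>I. \<forall>x. v r x = u r x))"

definition unique_global_bounded_solution where
  "unique_global_bounded_solution T mu d M X P D f g u \<longleftrightarrow>
     solution T mu d M X P D f g {0..T} u \<and> bounded_on {0..T} u \<and>
     (\<forall>v. solution T mu d M X P D f g {0..T} v \<and> bounded_on {0..T} v \<longrightarrow>
        (\<forall>r\<in>{0..T}. \<forall>x. v r x = u r x))"

primrec picard :: "real \<Rightarrow> real measure \<Rightarrow> (real \<Rightarrow> 'w \<Rightarrow> 's) \<Rightarrow> (real \<Rightarrow> 's \<Rightarrow> 'w measure)
    \<Rightarrow> (real \<Rightarrow> 's \<Rightarrow> 'v \<Rightarrow> 'v) \<Rightarrow> ('s \<Rightarrow> 'v::euclidean_space) \<Rightarrow> nat \<Rightarrow> real \<Rightarrow> 's \<Rightarrow> 'v" where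
  "picard T mu X P f g 0 = (\<lambda>r x. LINT \<omega>|P r x. g (X T \<omega>))"
| "picard T mu X P f g (Suc n) = (\<lambda>r x. (LINT \<omega>|P r x. g (X T \<omega>))
     - (LINT \<omega>|P r x. (LINT s:{r..T}|mu. f s (X s \<omega>) (picard T mu X P f g n s (X s \<omega>)))))"

text \<open>The integrals in the recursion exist; otherwise they would be \<open>0\<close> by convention.\<close>

definition picard_integrals_exist where
  "picard_integrals_exist T mu M X P f g \<longleftrightarrow> (\<forall>r\<in>{0..T}. \<forall>x.
     integrable (P r x) (\<lambda>\<omega>. g (X T \<omega>)) \<and>
     (\<forall>n. (\<forall>\<omega>\<in>space M.
            set_integrable mu {r..T} (\<lambda>s. f s (X s \<omega>) (picard T mu X P f g n s (X s \<omega>)))) \<and>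
          integrable (P r x)
            (\<lambda>\<omega>. LINT s:{r..T}|mu. f s (X s \<omega>) (picard T mu X P f g n s (X s \<omega>)))))"

end

theory Submission
  imports Defs
begin

text \<open>Set \<open>H(r) = \<integral>\<^bsub>[r,T]\<^esub> h d\<mu>\<close>. Since \<open>\<mu>\<close> has no atoms, \<open>H\<close> is continuous and
  \<open>\<integral>\<^bsub>[r,T]\<^esub> h exp (6 H) d\<mu> \<le> exp (6 H(r)) / 2\<close>. In the norm with weight
  \<open>exp (- 6 H)\<close>, the affine bound (with \<open>h\<close> dominating its coefficients) therefore keeps all Picard
  iterates in one ball; there \<open>f\<close> is Lipschitz with an integrable modulus \<open>k\<close>, and in the weighted norm
  for \<open>k\<close> the Picard map contracts by \<open>1 / 2\<close>. This gives convergence, and the same estimate on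
  \<open>[r,T]\<close> shows that every admissible solution agrees with the limit on its interval.
  The limit solves the equation by the Markov property for functionals of \<open>(X\<^sub>s)\<close>, \<open>s \<ge> t\<close>, obtained from
  the one-time Markov property by a Dynkin argument over cylinder events.\<close>

section \<open>Borel sets of the pseudometric\<close>

text \<open>The order of the two weights is forced: \<open>k\<close> depends on a ball, and that
  ball is known only after the growth bound has trapped the iterates. The main obstacle is the
  measurability of a single Picard step. The starting time \<open>r\<close> occurs twice, in the law
  \<open>P r x\<close> and as the lower limit of the time integral, whereas the hypotheses give
  measurability in the starting point only for a fixed later time; hence an approximation of
  \<open>r\<close> by grid points. Moreover, Borel sets refer to \<open>d\<close>, while progressive
  measurability refers to the product of time and paths; second countability of the state space
  links the two. Finally, the backward form of progressive measurability makes the integral over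
  \<open>{t..T}\<close> a functional of the path after \<open>t\<close>, which is exactly the class
  of functionals reached by the extended Markov property.\<close>

lemma separable_metrizable_imp_second_countable:
  assumes "metrizable_space X" "separable_space X"
  shows "second_countable X"
proof -
  obtain S m where m: "Metric_space S m" and X: "X = Metric_space.mtopology S m"
    using assms(1) unfolding metrizable_space_def by blast
  interpret Metric_space S m by fact
  obtain C where C: "countable C" "C \<subseteq> S" "X closure_of C = S"
    using assms(2) unfolding separable_space_def X by auto
  define B where "B = (\<lambda>(c, n). mball c (1 / Suc n)) ` (C \<times> (UNIV :: nat set))"
  have "\<exists>V\<in>B. x \<in> V \<and> V \<subseteq> U" if U: "openin X U" "x \<in> U" for U x
  proof -
    have xS: "x \<in> S" using U X openin_mtopology by blast
    obtain r where r: "r > 0" "mball x r \<subseteq> U"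
      using U X openin_mtopology by metis
    \<comment> \<open>Half the radius: a ball of radius below \<open>r / 2\<close> that contains
      \<open>x\<close> lies in \<open>mball x r\<close>.\<close>
    obtain n :: nat where n: "1 / Suc n < r / 2"
      using r(1) nat_approx_posE[of "r/2"] by auto
    have "x \<in> X closure_of C" using C xS by simp
    then have "\<forall>r>0. \<exists>y\<in>C. y \<in> mball x r"
      unfolding X metric_closure_of by blast
    moreover have "0 < 1 / real (Suc n)" by simp
    ultimately obtain c where c: "c \<in> C" "c \<in> mball x (1 / Suc n)"
      by blast
    have "mball c (1 / Suc n) \<subseteq> mball x r"
    proof
      fix z assume z: "z \<in> mball c (1 / Suc n)"
      have "m x z \<le> m x c + m c z" using z c xS triangle by auto
      also have "\<dots> < r" using z c n by auto
      finally show "z \<in> mball x r" using z xS by auto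
    qed
    moreover have "x \<in> mball c (1 / Suc n)" using c commute[of c x] by simp
    ultimately show ?thesis using c r unfolding B_def by blast
  qed
  moreover have "countable B" using C by (auto simp: B_def)
  moreover have "openin X V" if "V \<in> B" for V using that by (auto simp: B_def X)
  ultimately show ?thesis unfolding second_countable_def by blast
qed

section \<open>Borel sets on time slabs\<close>

lemma space_pm_borel [simp]: "space (pm_borel d A) = A"
  by (simp add: pm_borel_def space_measure_of_conv)

lemma pm_openin_subset: "{U. pm_openin d A U} \<subseteq> Pow A"
  by (auto simp: pm_openin_def)

lemma sets_pm_borel: "sets (pm_borel d A) = sigma_sets A {U. pm_openin d A U}"
  unfolding pm_borel_def by (rule sets_measure_of[OF pm_openin_subset])

lemma measurable_pm_borelI:
  assumes "f \<in> space N \<rightarrow> A" and "\<And>U. pm_openin d A U \<Longrightarrow> f -` U \<inter> space N \<in> sets N"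
  shows "f \<in> N \<rightarrow>\<^sub>M pm_borel d A"
  unfolding pm_borel_def
  by (rule measurable_measure_of) (use assms in \<open>auto simp: pm_openin_def\<close>)

lemma borel_on_UNIV: "borel_on d I UNIV u \<longleftrightarrow> (\<lambda>(r, x). u r x) \<in> borel_measurable (pm_borel d (I \<times> UNIV))"
  unfolding borel_on_def measurable_restrict_space2_iff by simp

context time_state_pseudometric
begin

abbreviation TS where "TS \<equiv> {0..T} \<times> (UNIV :: 's set)"

abbreviation BTS where "BTS \<equiv> pm_borel d ({0..T} \<times> (UNIV :: 's set))"

lemma fst_measurable [measurable]: "fst \<in> borel_measurable BTS"
  by (rule time_measurable)

lemma time_slab_sets:
  assumes "I \<subseteq> {0..T}" "I \<in> sets borel"
  shows "I \<times> UNIV \<in> sets BTS"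
proof -
  have "fst -` I \<inter> space BTS \<in> sets BTS"
    using assms by measurable
  moreover have "fst -` I \<inter> space BTS = I \<times> UNIV"
    using assms by auto
  ultimately show ?thesis by simp
qed

text \<open>The Borel sets of a smaller slab are defined from the restricted pseudometric and not as
  traces. The two agree because every relatively open set is the trace of a union of
  \<open>d\<close>-balls of the whole space.\<close>

lemma sets_pm_borel_slab:
  assumes "I \<subseteq> {0..T}" "I \<in> sets borel"
  shows "sets (pm_borel d (I \<times> UNIV)) = sets (restrict_space BTS (I \<times> UNIV))"
proof -
  have "(\<inter>) (I \<times> UNIV) ` {U. pm_openin d TS U} = {U. pm_openin d (I \<times> UNIV) U}"
  proof (intro equalityI subsetI)
    fix W assume "W \<in> (\<inter>) (I \<times> UNIV) ` {U. pm_openin d TS U}"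
    then obtain U where W: "W = (I \<times> UNIV) \<inter> U" and U: "pm_openin d TS U" by auto
    have "\<exists>e>0. \<forall>q\<in>I \<times> UNIV. d p q < e \<longrightarrow> q \<in> W" if "p \<in> W" for p
    proof -
      have "p \<in> U" using that W by simp
      then have "\<exists>e>0. \<forall>q\<in>TS. d p q < e \<longrightarrow> q \<in> U"
        using U unfolding pm_openin_def by simp
      then obtain e where e: "e > 0" "\<forall>q\<in>TS. d p q < e \<longrightarrow> q \<in> U" by (elim exE conjE)
      have "q \<in> W" if "q \<in> I \<times> UNIV" "d p q < e" for q
      proof -
        have "q \<in> TS" using that assms by auto
        then show ?thesis using e that W by blast
      qed
      then show ?thesis using e by blast
    qed
    then show "W \<in> {U. pm_openin d (I \<times> UNIV) U}" unfolding pm_openin_def W by blast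
  next
    fix W assume "W \<in> {U. pm_openin d (I \<times> UNIV) U}"
    then have W: "W \<subseteq> I \<times> UNIV"
      and "\<forall>p\<in>W. \<exists>e. e > 0 \<and> (\<forall>q\<in>I \<times> UNIV. d p q < e \<longrightarrow> q \<in> W)"
      by (auto simp: pm_openin_def)
    then obtain e where e: "\<And>p. p \<in> W \<Longrightarrow> e p > 0"
      "\<And>p q. p \<in> W \<Longrightarrow> q \<in> I \<times> UNIV \<Longrightarrow> d p q < e p \<Longrightarrow> q \<in> W"
      by metis
    \<comment> \<open>\<open>V\<close> is the union of the balls of radius \<open>e p\<close> around
      the points \<open>p\<close> of \<open>W\<close>, taken in the whole space; the triangle
      inequality makes it open.\<close>
    define V where "V = {q \<in> TS. \<exists>p\<in>W. d p q < e p}"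
    have WA: "p \<in> TS" if "p \<in> W" for p using that W assms by auto
    have "\<exists>\<epsilon>>0. \<forall>z\<in>TS. d q z < \<epsilon> \<longrightarrow> z \<in> V" if q: "q \<in> V" for q
    proof -
      obtain p where p: "p \<in> W" "d p q < e p" "q \<in> TS" using q by (auto simp: V_def)
      have "z \<in> V" if "z \<in> TS" "d q z < e p - d p q" for z
        using triangle[OF WA[OF p(1)] p(3) that(1)] that p by (auto simp: V_def intro!: bexI[of _ p])
      then show ?thesis using p by (intro exI[of _ "e p - d p q"]) simp
    qed
    then have "pm_openin d TS V" by (auto simp: pm_openin_def V_def)
    moreover have "W = (I \<times> UNIV) \<inter> V"
    proof (intro equalityI subsetI)
      fix p assume p: "p \<in> W"
      then have "p \<in> TS" "d p p < e p" using WA e(1) refl[of p] by simp_all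
      then have "p \<in> V" using p unfolding V_def by blast
      then show "p \<in> (I \<times> UNIV) \<inter> V" using p W by blast
    next
      fix p assume "p \<in> (I \<times> UNIV) \<inter> V"
      then show "p \<in> W" using e(2) unfolding V_def by blast
    qed
    ultimately show "W \<in> (\<inter>) (I \<times> UNIV) ` {U. pm_openin d TS U}" by blast
  qed
  moreover have "(\<inter>) (I \<times> UNIV) ` sigma_sets TS {U. pm_openin d TS U} =
      sigma_sets (I \<times> UNIV) ((\<inter>) (I \<times> UNIV) ` {U. pm_openin d TS U})"
    by (rule sigma_sets_Int) (use assms time_slab_sets[OF assms, unfolded sets_pm_borel] in auto)
  ultimately show ?thesis
    by (simp add: sets_pm_borel sets_restrict_space)
qed

lemma measurable_slab_iff:
  assumes "I \<subseteq> {0..T}" "I \<in> sets borel"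
  shows "f \<in> pm_borel d (I \<times> UNIV) \<rightarrow>\<^sub>M N \<longleftrightarrow> f \<in> restrict_space BTS (I \<times> UNIV) \<rightarrow>\<^sub>M N"
  by (rule arg_cong[where f = "\<lambda>S. f \<in> S"], rule measurable_cong_sets) (simp_all add: sets_pm_borel_slab[OF assms])

text \<open>Extension by zero lets Borel maps from different slabs be combined on the single space
  \<open>BTS\<close>.\<close>

lemma borel_on_slab_iff:
  fixes u :: "real \<Rightarrow> 's \<Rightarrow> 'b::{real_normed_vector, second_countable_topology}"
  assumes "I \<subseteq> {0..T}" "I \<in> sets borel"
  shows "borel_on d I UNIV u \<longleftrightarrow> (\<lambda>(r, x). indicator I r *\<^sub>R u r x) \<in> borel_measurable BTS"
proof -
  have "I \<times> UNIV \<inter> space BTS \<in> sets BTS"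
    using time_slab_sets[OF assms] by (metis sets.Int sets.top)
  then have "(\<lambda>p. case p of (r, x) \<Rightarrow> u r x) \<in> borel_measurable (restrict_space BTS (I \<times> UNIV)) \<longleftrightarrow>
      (\<lambda>p. indicator (I \<times> UNIV) p *\<^sub>R (case p of (r, x) \<Rightarrow> u r x)) \<in> borel_measurable BTS"
    by (rule borel_measurable_restrict_space_iff)
  moreover have "(\<lambda>p. indicator (I \<times> UNIV) p *\<^sub>R (case p of (r, x) \<Rightarrow> u r x))
      = (\<lambda>(r, x). indicator I r *\<^sub>R u r x)"
    by (auto simp: indicator_def fun_eq_iff)
  ultimately show ?thesis
    by (simp add: borel_on_UNIV measurable_slab_iff[OF assms])
qed

text \<open>Points at distance zero lie in the same Borel sets, so Borel maps are consistent.\<close>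

lemma borel_sets_not_separating:
  assumes "I \<subseteq> {0..T}" "p \<in> I \<times> UNIV" "q \<in> I \<times> UNIV" "d p q = 0"
    and "V \<in> sets (pm_borel d (I \<times> UNIV))"
  shows "p \<in> V \<longleftrightarrow> q \<in> V"
proof -
  have TS: "p \<in> TS" "q \<in> TS" using assms by auto
  then have "d q p = 0" using sym assms by simp
  from assms(5) have "V \<in> sigma_sets (I \<times> UNIV) {U. pm_openin d (I \<times> UNIV) U}"
    by (simp add: sets_pm_borel)
  then show ?thesis
  proof induct
    case (Basic U)
    then show ?case using assms \<open>d q p = 0\<close> unfolding pm_openin_def by fastforce
  qed (use assms in auto)
qed

lemma borel_on_imp_consistent_on:
  fixes u :: "real \<Rightarrow> 's \<Rightarrow> 'b::t1_space"
  assumes "I \<subseteq> {0..T}" "borel_on d I UNIV u"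
  shows "consistent_on d I u"
  unfolding consistent_on_def
proof (intro ballI allI impI)
  fix r s x y assume rs: "r \<in> I" "s \<in> I" "d (r, x) (s, y) = 0"
  \<comment> \<open>Singletons are closed in a \<open>t1_space\<close>, so this level set of
    \<open>u\<close> is Borel and cannot separate the two points.\<close>
  let ?V = "(\<lambda>(r, x). u r x) -` {u r x} \<inter> (I \<times> UNIV)"
  have "?V \<in> sets (pm_borel d (I \<times> UNIV))"
    using measurable_sets[OF assms(2)[unfolded borel_on_UNIV], of "{u r x}"] by simp
  from borel_sets_not_separating[OF assms(1) _ _ rs(3) this]
  show "u r x = u s y" using rs by auto
qed

section \<open>Joint measurability of time and state\<close>

lemma measurable_Pair_state:
  assumes "s \<in> {0..T}"
  shows "Pair s \<in> borel \<rightarrow>\<^sub>M BTS"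
proof (rule measurable_pm_borelI)
  fix U assume "pm_openin d TS U"
  from coarser[OF this] obtain V where V: "open V" "U = TS \<inter> V"
    by (auto simp: openin_open)
  have "Pair s -` U = Pair s -` V" using V assms by auto
  also have "open \<dots>" by (intro open_vimage V continuous_intros)
  finally show "Pair s -` U \<inter> space borel \<in> sets borel" by simp
qed (use assms in auto)

text \<open>A countable base of the second factor is enough: \<open>P n\<close> is the largest open
  set whose product with the base set \<open>Q n\<close> stays inside \<open>V\<close>, and these
  countably many rectangles exhaust \<open>V\<close>.\<close>

lemma open_in_product_countable_rectangles:
  fixes V :: "('a::topological_space \<times> 's) set"
  assumes "second_countable (euclidean :: 's topology)" "open V"
  obtains P :: "nat \<Rightarrow> 'a set" and Q :: "nat \<Rightarrow> 's set"
  where "\<And>n. open (P n)" "\<And>n. open (Q n)" "V = (\<Union>n. P n \<times> Q n)"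
proof -
  obtain \<B> :: "'s set set" where \<B>: "countable \<B>" "\<forall>V\<in>\<B>. open V"
    "\<And>U x. open U \<Longrightarrow> x \<in> U \<Longrightarrow> \<exists>V\<in>\<B>. x \<in> V \<and> V \<subseteq> U"
    using assms(1) unfolding second_countable_def by auto
  define Q where "Q = from_nat_into (insert {} \<B>)"
  \<comment> \<open>The empty set is added so that the enumerated family is nonempty.\<close>
  have Q: "range Q = insert {} \<B>" unfolding Q_def using \<B> by (simp add: range_from_nat_into)
  define P where "P n = \<Union>{W. open W \<and> W \<times> Q n \<subseteq> V}" for n
  have "open (P n)" for n by (auto simp: P_def)
  moreover have "open (Q n)" for n using Q \<B>(2) by (metis insert_iff open_empty rangeI)
  moreover have "V = (\<Union>n. P n \<times> Q n)"
  proof (intro equalityI subsetI)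
    fix z assume "z \<in> V"
    then obtain W U where WU: "open W" "open U" "z \<in> W \<times> U" "W \<times> U \<subseteq> V"
      using \<open>open V\<close> by (auto simp: open_prod_def)
    then obtain C where C: "C \<in> \<B>" "snd z \<in> C" "C \<subseteq> U" using \<B>(3)[of U "snd z"] by auto
    then obtain n where n: "C = Q n" using Q by (metis insertI2 rangeE)
    have "W \<times> Q n \<subseteq> V" using WU(4) C(3) n by blast
    then have "fst z \<in> P n" using WU by (auto simp: P_def)
    then have "z \<in> P n \<times> Q n" using C n by (cases z) auto
    then show "z \<in> (\<Union>n. P n \<times> Q n)" by blast
  qed (auto simp: P_def)
  ultimately show ?thesis by (rule that)
qed

text \<open>The Borel sets of \<open>d\<close> come without a generator of rectangles, so the two
  components cannot be tested directly. A \<open>d\<close>-open set is, however, relatively open in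
  the product topology, hence the trace of a countable union of open rectangles, and each of these
  is tested componentwise.\<close>

lemma measurable_time_Pair:
  assumes "second_countable (euclidean :: 's topology)" and "J \<subseteq> {0..T}"
    and X: "(\<lambda>(s, \<omega>). X s \<omega>) \<in> restrict_space borel J \<Otimes>\<^sub>M N \<rightarrow>\<^sub>M (borel :: 's measure)"
  shows "(\<lambda>(s, \<omega>). (s, X s \<omega>)) \<in> restrict_space borel J \<Otimes>\<^sub>M N \<rightarrow>\<^sub>M BTS"
proof (rule measurable_pm_borelI)
  show "(\<lambda>(s, \<omega>). (s, X s \<omega>)) \<in> space (restrict_space borel J \<Otimes>\<^sub>M N) \<rightarrow> TS"
    using assms by (auto simp: space_pair_measure space_restrict_space)
  fix U assume "pm_openin d TS U"
  from coarser[OF this] obtain V where V: "open V" "U = TS \<inter> V"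
    by (auto simp: openin_open)
  obtain P :: "nat \<Rightarrow> real set" and Q :: "nat \<Rightarrow> 's set" where PQ: "\<And>n. open (P n)" "\<And>n. open (Q n)" "V = (\<Union>n. P n \<times> Q n)"
    by (rule open_in_product_countable_rectangles[OF assms(1) V(1)]) blast
  let ?M = "restrict_space borel J \<Otimes>\<^sub>M N"
  have fst: "fst \<in> borel_measurable ?M"
    by (rule measurable_compose[OF measurable_fst]) (simp add: measurable_restrict_space1)
  have "(\<lambda>(s, \<omega>). (s, X s \<omega>)) -` U \<inter> space ?M =
    (\<Union>n. (fst -` P n \<inter> space ?M) \<inter> ((\<lambda>(s, \<omega>). X s \<omega>) -` Q n \<inter> space ?M))"
    using assms(2) unfolding V PQ by (auto simp: space_pair_measure space_restrict_space)
  also have "\<dots> \<in> sets ?M"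
    using PQ measurable_sets[OF fst] measurable_sets[OF X] by (intro sets.countable_UN' sets.Int) auto
  finally show "(\<lambda>(s, \<omega>). (s, X s \<omega>)) -` U \<inter> space ?M \<in> sets ?M" .
qed

end

section \<open>The Markov property for cylinder events\<close>

locale progressive_markov_pseudometric =
  time_state_pseudometric T d + consistent_progressive_markov T d M X F P
  for T :: real and d :: "real \<times> 's::topological_space \<Rightarrow> real \<times> 's \<Rightarrow> real"
    and M :: "'w measure" and X F and P :: "real \<Rightarrow> 's \<Rightarrow> 'w measure" +
  assumes second_countable_state: "second_countable (euclidean :: 's topology)"
begin

abbreviation future :: "real \<Rightarrow> 'w measure" where "future t \<equiv> natural_sigma M X {t..T}"

abbreviation slab :: "real \<Rightarrow> (real \<times> 's) measure" where "slab t \<equiv> pm_borel d ({0..t} \<times> UNIV)"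

lemma space_P: "r \<in> {0..T} \<Longrightarrow> space (P r x) = space M"
  using sets_eq_imp_space_eq[OF sets_P] by blast

lemma measurable_P: "r \<in> {0..T} \<Longrightarrow> f \<in> P r x \<rightarrow>\<^sub>M K \<longleftrightarrow> f \<in> M \<rightarrow>\<^sub>M K"
  by (simp cong: measurable_cong_sets add: sets_P)

lemma subalgebra_P: "r \<in> {0..T} \<Longrightarrow> subalgebra (P r x) G \<longleftrightarrow> subalgebra M G"
  by (simp add: subalgebra_def sets_P space_P)

lemma measurable_X: "t \<in> {0..T} \<Longrightarrow> X t \<in> M \<rightarrow>\<^sub>M borel"
  using measurable_from_subalg[OF filtration_sub adapted] by blast

lemma measurable_X_P: "r \<in> {0..T} \<Longrightarrow> t \<in> {0..T} \<Longrightarrow> X t \<in> P r x \<rightarrow>\<^sub>M borel"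
  using measurable_P measurable_X by blast

lemma natural_sigma_gen_subset: "{X s -` B \<inter> space M | s B. s \<in> J \<and> B \<in> sets borel} \<subseteq> Pow (space M)"
  by auto

lemma space_natural_sigma [simp]: "space (natural_sigma M X J) = space M"
  by (simp add: natural_sigma_def space_measure_of_conv)

lemma sets_natural_sigma: "sets (natural_sigma M X J) =
    sigma_sets (space M) {X s -` B \<inter> space M | s B. s \<in> J \<and> B \<in> sets borel}"
  unfolding natural_sigma_def by (rule sets_measure_of[OF natural_sigma_gen_subset])

lemma subalgebra_natural_sigma:
  assumes "J \<subseteq> {0..T}"
  shows "subalgebra M (natural_sigma M X J)"
  unfolding subalgebra_def
proof
  show "sets (natural_sigma M X J) \<subseteq> sets M"
    unfolding sets_natural_sigma
    by (rule sets.sigma_sets_subset) (use measurable_X assms measurable_sets in blast)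
qed simp

lemma measurable_X_natural_sigma:
  assumes "s \<in> J"
  shows "X s \<in> natural_sigma M X J \<rightarrow>\<^sub>M borel"
proof (rule measurableI)
  fix B :: "'s set" assume "B \<in> sets borel"
  then have "X s -` B \<inter> space M \<in> {X s -` B \<inter> space M | s B. s \<in> J \<and> B \<in> sets borel}"
    using assms by blast
  then show "X s -` B \<inter> space (natural_sigma M X J) \<in> sets (natural_sigma M X J)"
    by (simp add: sets_natural_sigma sigma_sets.Basic)
qed simp

lemma Icc_borel: "{a..b::real} \<in> sets borel" by simp

lemma measurable_Pair_slab:
  assumes "I \<subseteq> {0..T}" "I \<in> sets borel" "s \<in> I"
  shows "Pair s \<in> borel \<rightarrow>\<^sub>M pm_borel d (I \<times> UNIV)"
proof -
  have "Pair s \<in> borel \<rightarrow>\<^sub>M restrict_space BTS (I \<times> UNIV)"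
    using assms by (intro measurable_restrict_space2 measurable_Pair_state) auto
  then show ?thesis
    using measurable_cong_sets[OF HOL.refl sets_pm_borel_slab[OF assms(1,2)], of borel] by auto
qed

lemma measurable_slab_mono:
  assumes "f \<in> pm_borel d (I \<times> UNIV) \<rightarrow>\<^sub>M K" "J \<subseteq> I" "I \<subseteq> {0..T}" "I \<in> sets borel" "J \<in> sets borel"
  shows "f \<in> pm_borel d (J \<times> UNIV) \<rightarrow>\<^sub>M K"
proof -
  have "restrict_space (restrict_space BTS (I \<times> UNIV)) (J \<times> UNIV) = restrict_space BTS (J \<times> UNIV)"
    using assms(2) by (subst restrict_restrict_space)
      (auto intro!: arg_cong2[where f = restrict_space] sets.Int time_slab_sets[OF assms(3,4)]
        time_slab_sets[OF subset_trans[OF assms(2,3)] assms(5)] simp del: space_pm_borel)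
  moreover have "f \<in> restrict_space (restrict_space BTS (I \<times> UNIV)) (J \<times> UNIV) \<rightarrow>\<^sub>M K"
    using assms(1) unfolding measurable_slab_iff[OF assms(3,4)] by (rule measurable_restrict_space1)
  ultimately show ?thesis
    unfolding measurable_slab_iff[OF subset_trans[OF assms(2,3)] assms(5)] by (rule subst)
qed

text \<open>As a kernel, the transition probabilities can be integrated measurably against arbitrary
  functions, and mixed by \<open>bind\<close>, instead of being handled one event \<open>B\<close>
  at a time.\<close>

lemma transition_kernel_measurable:
  assumes "0 \<le> t" "t \<le> T"
  shows "(\<lambda>(s, x). distr (P s x) borel (X t)) \<in> slab t \<rightarrow>\<^sub>M subprob_algebra borel"
proof (rule measurable_subprob_algebra)
  fix p assume "p \<in> space (slab t)"
  then obtain s x where p: "p = (s, x)" "s \<in> {0..T}" using assms by auto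
  then interpret prob_space "P s x" using prob by simp
  have "X t \<in> P s x \<rightarrow>\<^sub>M borel" using p assms by (intro measurable_X_P) auto
  from prob_space_distr[OF this]
  show "subprob_space (case p of (s, x) \<Rightarrow> distr (P s x) borel (X t))"
    by (simp add: p prob_space_imp_subprob_space)
  show "sets (case p of (s, x) \<Rightarrow> distr (P s x) borel (X t)) = sets borel" by (simp add: p)
next
  fix B :: "'s set" assume B: "B \<in> sets borel"
  have "(\<lambda>(s, x). measure (P s x) {\<omega> \<in> space M. X t \<omega> \<in> B}) \<in> borel_measurable (slab t)"
    using transition_borel[of t B] assms B unfolding borel_on_def measurable_restrict_space2_iff by simp
  then have "(\<lambda>p. ennreal (case p of (s, x) \<Rightarrow> measure (P s x) {\<omega> \<in> space M. X t \<omega> \<in> B})) \<in> borel_measurable (slab t)"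
    by measurable
  moreover have "ennreal (measure (P s x) {\<omega> \<in> space M. X t \<omega> \<in> B}) = emeasure (distr (P s x) borel (X t)) B"
    if "s \<in> {0..t}" for s x
  proof -
    have s: "s \<in> {0..T}" using that assms by auto
    then interpret prob_space "P s x" using prob by simp
    have "X t \<in> P s x \<rightarrow>\<^sub>M borel" using s assms by (intro measurable_X_P) auto
    then have "emeasure (distr (P s x) borel (X t)) B = emeasure (P s x) (X t -` B \<inter> space M)"
      using B s by (simp add: emeasure_distr space_P)
    also have "X t -` B \<inter> space M = {\<omega> \<in> space M. X t \<omega> \<in> B}" by auto
    finally show ?thesis by (simp add: emeasure_eq_measure)
  qed
  ultimately show "(\<lambda>a. emeasure (case a of (s, x) \<Rightarrow> distr (P s x) borel (X t)) B) \<in> borel_measurable (slab t)"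
    by (subst measurable_cong[where g = "\<lambda>p. ennreal (case p of (s, x) \<Rightarrow> measure (P s x) {\<omega> \<in> space M. X t \<omega> \<in> B})"])
      (auto split: prod.splits)
qed

lemma state_kernel_measurable:
  assumes "0 \<le> s" "s \<le> t" "t \<le> T"
  shows "(\<lambda>y. distr (P s y) borel (X t)) \<in> borel \<rightarrow>\<^sub>M subprob_algebra borel"
proof -
  have "Pair s \<in> borel \<rightarrow>\<^sub>M slab t"
    by (rule measurable_Pair_slab) (use assms in auto)
  from measurable_compose[OF this transition_kernel_measurable] show ?thesis
    using assms by simp
qed

text \<open>Integrating the conditional form over an event of \<open>F s\<close> removes the
  exceptional null set, which may depend on \<open>B\<close>. The result is an exact identity for
  every \<open>B\<close>, so that measures can be compared.\<close>

lemma markov_emeasure: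
  assumes rst: "0 \<le> r" "r \<le> s" "s \<le> t" "t \<le> T" and A: "A \<in> sets (F s)" and B: "B \<in> sets borel"
  shows "emeasure (P r x) (A \<inter> (X t -` B \<inter> space M)) =
    (\<integral>\<^sup>+\<omega>. indicator A \<omega> * emeasure (distr (P s (X s \<omega>)) borel (X t)) B \<partial>P r x)"
proof -
  have r: "r \<in> {0..T}" and s: "s \<in> {0..T}" and t: "t \<in> {0..T}" using rst by auto
  interpret prob_space "P r x" using prob r by simp
  have sub: "subalgebra (P r x) (F s)" using subalgebra_P[OF r] filtration_sub[OF s] by simp
  interpret finite_measure_subalgebra "P r x" "F s" by unfold_locales (rule sub)
  have AM: "A \<in> sets (P r x)" using A sub by (auto simp: subalgebra_def)
  have Xt[measurable]: "X t \<in> P r x \<rightarrow>\<^sub>M borel" and Xs[measurable]: "X s \<in> P r x \<rightarrow>\<^sub>M borel"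
    using r s t by (auto intro: measurable_X_P)
  note [measurable] = AM B
  let ?f = "\<lambda>\<omega>. indicator B (X t \<omega>) :: real"
  let ?p = "\<lambda>\<omega>. measure (P s (X s \<omega>)) {\<omega>' \<in> space M. X t \<omega>' \<in> B}"
  have eD: "emeasure (distr (P s y) borel (X t)) B = ennreal (measure (P s y) {\<omega>' \<in> space M. X t \<omega>' \<in> B})" for y
  proof -
    interpret S: prob_space "P s y" using prob s by simp
    have "emeasure (distr (P s y) borel (X t)) B = emeasure (P s y) (X t -` B \<inter> space M)"
      using B measurable_X_P[OF s t] by (simp add: emeasure_distr space_P[OF s])
    also have "X t -` B \<inter> space M = {\<omega> \<in> space M. X t \<omega> \<in> B}" by auto
    finally show ?thesis by (simp add: S.emeasure_eq_measure)
  qed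
  have "(\<lambda>y. emeasure (distr (P s y) borel (X t)) B) \<in> borel_measurable borel"
    by (rule measurable_emeasure_kernel[OF state_kernel_measurable B]) (use rst in auto)
  then have "(\<lambda>y. enn2real (emeasure (distr (P s y) borel (X t)) B)) \<in> borel_measurable borel"
    by measurable
  then have [measurable]: "(\<lambda>y. measure (P s y) {\<omega>' \<in> space M. X t \<omega>' \<in> B}) \<in> borel_measurable borel"
    by (simp add: eD)
  have p1: "?p \<omega> \<le> 1" for \<omega>
    using prob[OF s] by (simp add: prob_space.prob_le_1)
  have ints: "integrable (P r x) ?f" "integrable (P r x) (\<lambda>\<omega>. indicator A \<omega> * ?p \<omega>)"
    by (rule integrable_const_bound[where B = 1]; use p1 in \<open>auto simp: indicator_def\<close>)+
  have "measure (P r x) (A \<inter> (X t -` B \<inter> space M)) = (LINT \<omega>|P r x. indicator A \<omega> * ?f \<omega>)"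
  proof -
    have "A \<inter> (X t -` B \<inter> space M) \<in> sets (P r x)"
      using AM measurable_sets[OF Xt B] space_P[OF r] by auto
    moreover have "indicator A \<omega> * ?f \<omega> = indicator (A \<inter> (X t -` B \<inter> space M)) \<omega>"
      if "\<omega> \<in> space (P r x)" for \<omega>
      using that space_P[OF r] by (auto simp: indicator_def)
    ultimately show ?thesis
      by (simp add: integral_indicator emeasure_eq_measure cong: Bochner_Integration.integral_cong)
  qed
  also have "\<dots> = (LINT \<omega>|P r x. indicator A \<omega> * real_cond_exp (P r x) (F s) ?f \<omega>)"
    using real_cond_exp_intA[OF ints(1) A] by (simp add: set_lebesgue_integral_def)
  also have "\<dots> = (LINT \<omega>|P r x. indicator A \<omega> * ?p \<omega>)"
  proof (rule integral_cong_AE)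
    show "AE \<omega> in P r x. indicator A \<omega> * real_cond_exp (P r x) (F s) ?f \<omega> = indicator A \<omega> * ?p \<omega>"
      using markov[OF rst B] by eventually_elim simp
  qed measurable
  finally have "ennreal (measure (P r x) (A \<inter> (X t -` B \<inter> space M))) =
      (\<integral>\<^sup>+\<omega>. ennreal (indicator A \<omega> * ?p \<omega>) \<partial>P r x)"
    using ints(2) by (simp add: nn_integral_eq_integral)
  also have "\<dots> = (\<integral>\<^sup>+\<omega>. indicator A \<omega> * emeasure (distr (P s (X s \<omega>)) borel (X t)) B \<partial>P r x)"
    by (rule nn_integral_cong) (auto simp: eD indicator_def)
  finally show ?thesis by (simp add: emeasure_eq_measure)
qed

text \<open>Both sides integrate \<open>\<phi>\<close> against a measure on the states: the law of
  \<open>X t\<close> under \<open>P r x\<close> cut down to \<open>A\<close>, and the mixture of the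
  kernels started at \<open>X s\<close> under the same cut-down measure. By
  \<open>markov_emeasure\<close> these measures coincide.\<close>

lemma markov_nn_integral:
  assumes rst: "0 \<le> r" "r \<le> s" "s \<le> t" "t \<le> T" and A: "A \<in> sets (F s)" and \<phi>: "\<phi> \<in> borel_measurable borel"
  shows "(\<integral>\<^sup>+\<omega>. indicator A \<omega> * \<phi> (X t \<omega>) \<partial>P r x) =
    (\<integral>\<^sup>+\<omega>. indicator A \<omega> * (\<integral>\<^sup>+\<omega>'. \<phi> (X t \<omega>') \<partial>P s (X s \<omega>)) \<partial>P r x)"
proof -
  have r: "r \<in> {0..T}" and s: "s \<in> {0..T}" and t: "t \<in> {0..T}" using rst by auto
  interpret prob_space "P r x" using prob r by simp
  have sub: "subalgebra (P r x) (F s)" using subalgebra_P[OF r] filtration_sub[OF s] by simp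
  have AM: "A \<in> sets (P r x)" using A sub by (auto simp: subalgebra_def)
  have Xt[measurable]: "X t \<in> P r x \<rightarrow>\<^sub>M borel" and Xs[measurable]: "X s \<in> P r x \<rightarrow>\<^sub>M borel"
    using r s t by (auto intro: measurable_X_P)
  note [measurable] = AM \<phi>
  define K where "K = (\<lambda>y. distr (P s y) borel (X t))"
  have K[measurable]: "K \<in> borel \<rightarrow>\<^sub>M subprob_algebra borel"
    unfolding K_def by (rule state_kernel_measurable) (use rst in auto)
  let ?Q = "density (P r x) (indicator A)"
  have ne: "space ?Q \<noteq> {}" using not_empty by simp
  have KX: "(\<lambda>\<omega>. K (X s \<omega>)) \<in> ?Q \<rightarrow>\<^sub>M subprob_algebra borel" by measurable
  have "distr ?Q borel (X t) = ?Q \<bind> (\<lambda>\<omega>. K (X s \<omega>))"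
  proof (rule measure_eqI)
    show "sets (distr ?Q borel (X t)) = sets (?Q \<bind> (\<lambda>\<omega>. K (X s \<omega>)))"
      using sets_bind[OF sets_kernel[OF KX] ne] by simp
    fix B assume "B \<in> sets (distr ?Q borel (X t))"
    then have B: "B \<in> sets borel" by simp
    then have [measurable]: "B \<in> sets borel" "X t -` B \<inter> space M \<in> sets (P r x)"
      using measurable_sets[OF Xt] space_P[OF r] by auto
    have "emeasure (distr ?Q borel (X t)) B = emeasure ?Q (X t -` B \<inter> space M)"
      using B space_P[OF r] by (simp add: emeasure_distr)
    also have "\<dots> = (\<integral>\<^sup>+\<omega>. indicator (A \<inter> (X t -` B \<inter> space M)) \<omega> \<partial>P r x)"
      by (simp add: emeasure_density indicator_inter_arith)
    also have "\<dots> = emeasure (P r x) (A \<inter> (X t -` B \<inter> space M))"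
      by (rule nn_integral_indicator) measurable
    also have "\<dots> = (\<integral>\<^sup>+\<omega>. indicator A \<omega> * emeasure (K (X s \<omega>)) B \<partial>P r x)"
      unfolding K_def by (rule markov_emeasure[OF rst A B])
    also have "\<dots> = (\<integral>\<^sup>+\<omega>. emeasure (K (X s \<omega>)) B \<partial>?Q)"
      by (rule nn_integral_density[symmetric]) measurable
    also have "\<dots> = emeasure (?Q \<bind> (\<lambda>\<omega>. K (X s \<omega>))) B"
      by (rule emeasure_bind[symmetric, OF ne KX B])
    finally show "emeasure (distr ?Q borel (X t)) B = emeasure (?Q \<bind> (\<lambda>\<omega>. K (X s \<omega>))) B" .
  qed
  then have "(\<integral>\<^sup>+y. \<phi> y \<partial>distr ?Q borel (X t)) = (\<integral>\<^sup>+y. \<phi> y \<partial>(?Q \<bind> (\<lambda>\<omega>. K (X s \<omega>))))"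
    by simp
  also have "\<dots> = (\<integral>\<^sup>+\<omega>. (\<integral>\<^sup>+y. \<phi> y \<partial>K (X s \<omega>)) \<partial>?Q)"
    by (rule nn_integral_bind[OF \<phi> KX])
  also have "\<dots> = (\<integral>\<^sup>+\<omega>. indicator A \<omega> * (\<integral>\<^sup>+y. \<phi> y \<partial>K (X s \<omega>)) \<partial>P r x)"
    by (rule nn_integral_density) measurable
  also have "\<dots> = (\<integral>\<^sup>+\<omega>. indicator A \<omega> * (\<integral>\<^sup>+\<omega>'. \<phi> (X t \<omega>') \<partial>P s (X s \<omega>)) \<partial>P r x)"
    unfolding K_def using measurable_X_P[OF s t] \<phi>
    by (simp add: nn_integral_distr)
  also have "(\<integral>\<^sup>+y. \<phi> y \<partial>distr ?Q borel (X t)) = (\<integral>\<^sup>+\<omega>. indicator A \<omega> * \<phi> (X t \<omega>) \<partial>P r x)"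
    by (simp add: nn_integral_distr nn_integral_density)
  finally show ?thesis .
qed

section \<open>Finite-dimensional events of the process\<close>

definition cylinder :: "real set \<Rightarrow> (real \<Rightarrow> 's set) \<Rightarrow> 'w set" where
  "cylinder J Bs = {\<omega> \<in> space M. \<forall>s\<in>J. X s \<omega> \<in> Bs s}"

lemma cylinder_insert: "cylinder (insert b J) Bs = (X b -` Bs b \<inter> space M) \<inter> cylinder J Bs"
  by (auto simp: cylinder_def)

lemma cylinder_sets_natural_sigma:
  assumes "finite J" "J \<subseteq> I" "\<And>s. Bs s \<in> sets borel"
  shows "cylinder J Bs \<in> sets (natural_sigma M X I)"
  using assms
proof (induct J)
  case empty
  have "cylinder {} Bs = space (natural_sigma M X I)" by (simp add: cylinder_def)
  then show ?case by (metis sets.top)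
next
  case (insert b J)
  then have "X b -` Bs b \<inter> space M \<in> sets (natural_sigma M X I)"
    using measurable_sets[OF measurable_X_natural_sigma[of b I] insert.prems(2)[of b]] by simp
  then show ?case using insert by (simp add: cylinder_insert sets.Int del: vimage_Int)
qed

text \<open>The events are peeled off at the earliest time \<open>b\<close>; the weight \<open>A\<close> lets the
  factor at time \<open>b\<close> be absorbed when the induction hypothesis is used at time \<open>b\<close>.\<close>

lemma markov_cylinder:
  assumes "finite J" "J \<subseteq> {t..T}" "0 \<le> t" "t \<le> T" "\<And>s. Bs s \<in> sets borel"
  shows "(\<lambda>(r, x). emeasure (P r x) (cylinder J Bs)) \<in> borel_measurable (slab t) \<and>
    (\<forall>r x A. 0 \<le> r \<and> r \<le> t \<and> A \<in> sets (F t) \<longrightarrow> emeasure (P r x) (A \<inter> cylinder J Bs) =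
      (\<integral>\<^sup>+\<omega>. indicator A \<omega> * emeasure (P t (X t \<omega>)) (cylinder J Bs) \<partial>P r x))"
  using assms(1-4)
proof (induct arbitrary: t rule: finite_linorder_min_induct)
  case empty
  have one: "emeasure (P r x) (cylinder {} Bs) = 1" if "r \<in> {0..T}" for r x
    using prob_space.emeasure_space_1[OF prob[OF that, of x]] space_P[OF that]
    by (simp add: cylinder_def)
  have "(\<lambda>(r, x). emeasure (P r x) (cylinder {} Bs)) \<in> borel_measurable (slab t) \<longleftrightarrow>
      (\<lambda>_. 1 :: ennreal) \<in> borel_measurable (slab t)"
    by (rule measurable_cong) (use one empty in auto)
  moreover have "(\<lambda>_. 1 :: ennreal) \<in> borel_measurable (slab t)" by simp
  moreover have "emeasure (P r x) (A \<inter> cylinder {} Bs) =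
      (\<integral>\<^sup>+\<omega>. indicator A \<omega> * emeasure (P t (X t \<omega>)) (cylinder {} Bs) \<partial>P r x)"
    if rA: "0 \<le> r" "r \<le> t" "A \<in> sets (F t)" for r x A
  proof -
    have r: "r \<in> {0..T}" and t: "t \<in> {0..T}" using rA empty by auto
    have A: "A \<in> sets (P r x)" using filtration_sub[OF t] rA by (auto simp: sets_P[OF r] subalgebra_def)
    then have "A \<subseteq> space M" using sets.sets_into_space space_P[OF r] by blast
    then have "A \<inter> cylinder {} Bs = A" by (auto simp: cylinder_def)
    then show ?thesis using A by (simp add: one[OF t])
  qed
  ultimately show ?case by blast
next
  case (insert b J)
  have b: "t \<le> b" "b \<le> T" "0 \<le> b" using insert.prems by auto
  have Jb: "J \<subseteq> {b..T}" using insert.prems(1) insert.hyps(2) by (auto simp: less_imp_le)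
  have bt: "b \<in> {0..T}" "t \<in> {0..T}" using b insert by auto
  \<comment> \<open>The probability of the remaining events, started at time \<open>b\<close>.
    Fixing the starting time in the induction hypothesis makes it measurable in the state.\<close>
  define h where "h y = emeasure (P b y) (cylinder J Bs)" for y
  define C where "C = X b -` Bs b \<inter> space M"
  define \<phi> where "\<phi> y = indicator (Bs b) y * h y" for y
  have IH: "(\<lambda>(r, x). emeasure (P r x) (cylinder J Bs)) \<in> borel_measurable (slab b)"
    "\<And>r x A. 0 \<le> r \<Longrightarrow> r \<le> b \<Longrightarrow> A \<in> sets (F b) \<Longrightarrow> emeasure (P r x) (A \<inter> cylinder J Bs) =
      (\<integral>\<^sup>+\<omega>. indicator A \<omega> * h (X b \<omega>) \<partial>P r x)"
    using insert.hyps(3)[OF Jb b(3,2)] unfolding h_def by blast+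
  have "Pair b \<in> borel \<rightarrow>\<^sub>M slab b"
    by (rule measurable_Pair_slab) (use b in auto)
  from measurable_compose[OF this IH(1)] have h[measurable]: "h \<in> borel_measurable borel"
    unfolding h_def by simp
  have [measurable]: "Bs b \<in> sets borel" by fact
  have \<phi>[measurable]: "\<phi> \<in> borel_measurable borel" unfolding \<phi>_def by measurable
  have C: "C \<in> sets (F b)"
    using measurable_sets[OF adapted[OF bt(1)] assms(5)[of b]] filtration_sub[OF bt(1)]
    by (simp add: C_def subalgebra_def)
  have weighted: "emeasure (P r x) (A \<inter> cylinder (insert b J) Bs) =
      (\<integral>\<^sup>+\<omega>. indicator A \<omega> * \<phi> (X b \<omega>) \<partial>P r x)"
    if "0 \<le> r" "r \<le> b" "A \<in> sets (F b)" for r x A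
  proof -
    have "A \<inter> C \<in> sets (F b)" using that C by auto
    from IH(2)[OF that(1,2) this, of x]
    have "emeasure (P r x) (A \<inter> C \<inter> cylinder J Bs) = (\<integral>\<^sup>+\<omega>. indicator (A \<inter> C) \<omega> * h (X b \<omega>) \<partial>P r x)" .
    also have "\<dots> = (\<integral>\<^sup>+\<omega>. indicator A \<omega> * \<phi> (X b \<omega>) \<partial>P r x)"
    proof (rule nn_integral_cong)
      fix \<omega> assume "\<omega> \<in> space (P r x)"
      then have "\<omega> \<in> space M" using space_P[of r x] that b by auto
      then show "indicator (A \<inter> C) \<omega> * h (X b \<omega>) = indicator A \<omega> * \<phi> (X b \<omega>)"
        by (auto simp: C_def \<phi>_def indicator_def)
    qed
    also have "A \<inter> C \<inter> cylinder J Bs = A \<inter> cylinder (insert b J) Bs"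
      by (auto simp: cylinder_insert C_def)
    finally show ?thesis .
  qed
  have full: "emeasure (P r x) (cylinder (insert b J) Bs) = (\<integral>\<^sup>+\<omega>. \<phi> (X b \<omega>) \<partial>P r x)"
    if "0 \<le> r" "r \<le> b" for r x
  proof -
    have "space M \<in> sets (F b)" using filtration_sub[OF bt(1)] by (metis sets.top subalgebra_def)
    from weighted[OF that this, of x]
    have "emeasure (P r x) (space M \<inter> cylinder (insert b J) Bs) =
      (\<integral>\<^sup>+\<omega>. indicator (space M) \<omega> * \<phi> (X b \<omega>) \<partial>P r x)" .
    also have "\<dots> = (\<integral>\<^sup>+\<omega>. \<phi> (X b \<omega>) \<partial>P r x)"
      using space_P[of r x] that b by (intro nn_integral_cong) auto
    also have "space M \<inter> cylinder (insert b J) Bs = cylinder (insert b J) Bs"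
      by (auto simp: cylinder_def)
    finally show ?thesis .
  qed
  have "(\<lambda>(r, x). emeasure (P r x) (cylinder (insert b J) Bs)) \<in> borel_measurable (slab t)"
  proof -
    have "(\<lambda>(r, x). distr (P r x) borel (X b)) \<in> slab t \<rightarrow>\<^sub>M subprob_algebra borel"
      by (rule measurable_slab_mono[OF transition_kernel_measurable]) (use b in auto)
    then have "(\<lambda>p. integral\<^sup>N (case p of (r, x) \<Rightarrow> distr (P r x) borel (X b)) \<phi>) \<in> borel_measurable (slab t)"
      by (rule measurable_compose[OF _ nn_integral_measurable_subprob_algebra[OF \<phi>]])
    moreover have "(case p of (r, x) \<Rightarrow> emeasure (P r x) (cylinder (insert b J) Bs)) =
        integral\<^sup>N (case p of (r, x) \<Rightarrow> distr (P r x) borel (X b)) \<phi>"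
      if "p \<in> space (slab t)" for p
    proof -
      obtain r x where p: "p = (r, x)" "0 \<le> r" "r \<le> t" using \<open>p \<in> space (slab t)\<close> by auto
      then have "r \<in> {0..T}" "r \<le> b" using b by auto
      then show ?thesis
        using full[of r x] p measurable_X_P[OF _ bt(1)] \<phi>
        by (simp add: nn_integral_distr)
    qed
    ultimately show ?thesis by (subst measurable_cong)
  qed
  moreover have "emeasure (P r x) (A \<inter> cylinder (insert b J) Bs) =
      (\<integral>\<^sup>+\<omega>. indicator A \<omega> * emeasure (P t (X t \<omega>)) (cylinder (insert b J) Bs) \<partial>P r x)"
    if rA: "0 \<le> r" "r \<le> t" "A \<in> sets (F t)" for r x A
  proof -
    \<comment> \<open>An event known at time \<open>t\<close> is also known at time
      \<open>b\<close>, so \<open>weighted\<close> applies first; the one-time Markov property then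
      moves from \<open>b\<close> back to \<open>t\<close>.\<close>
    have "A \<in> sets (F b)" using rA filtration_mono[of t b] b insert by auto
    then have "emeasure (P r x) (A \<inter> cylinder (insert b J) Bs) =
      (\<integral>\<^sup>+\<omega>. indicator A \<omega> * \<phi> (X b \<omega>) \<partial>P r x)" using rA b by (intro weighted) auto
    also have "\<dots> = (\<integral>\<^sup>+\<omega>. indicator A \<omega> * (\<integral>\<^sup>+\<omega>'. \<phi> (X b \<omega>') \<partial>P t (X t \<omega>)) \<partial>P r x)"
      by (rule markov_nn_integral) (use rA b in auto)
    finally show ?thesis using full[of t] b insert by simp
  qed
  ultimately show ?case by blast
qed

end

section \<open>The Markov property for functionals of the future\<close>

context progressive_markov_pseudometric
begin

text \<open>Unlike the one-time events in the definition, cylinders are stable under intersection,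
  as the Dynkin argument requires.\<close>

lemma sets_natural_sigma_cylinders:
  "sets (natural_sigma M X I) = sigma_sets (space M)
    {cylinder J Bs | J Bs. finite J \<and> J \<subseteq> I \<and> (\<forall>s. Bs s \<in> sets borel)}" (is "_ = sigma_sets _ ?G")
proof (rule antisym)
  have "X s -` B \<inter> space M \<in> ?G" if "s \<in> I" "B \<in> sets borel" for s B
  proof -
    have "X s -` B \<inter> space M = cylinder {s} (\<lambda>_. B)" by (auto simp: cylinder_def)
    then show ?thesis using that by blast
  qed
  then show "sets (natural_sigma M X I) \<subseteq> sigma_sets (space M) ?G"
    unfolding sets_natural_sigma by (intro sigma_sets_mono') blast
  have "?G \<subseteq> sets (natural_sigma M X I)"
    using cylinder_sets_natural_sigma by blast
  from sets.sigma_sets_subset[OF this]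
  show "sigma_sets (space M) ?G \<subseteq> sets (natural_sigma M X I)" by simp
qed

lemma Int_stable_cylinders:
  "Int_stable {cylinder J Bs | J Bs. finite J \<and> J \<subseteq> I \<and> (\<forall>s. Bs s \<in> sets borel)}"
proof (rule Int_stableI, safe)
  fix J J' :: "real set" and Bs Bs' :: "real \<Rightarrow> 's set"
  assume *: "finite J" "J \<subseteq> I" "\<forall>s. Bs s \<in> sets borel" "finite J'" "J' \<subseteq> I" "\<forall>s. Bs' s \<in> sets borel"
  \<comment> \<open>A cylinder imposes no condition outside its own index set, where its
    \<open>Bs\<close> may be arbitrary; \<open>UNIV\<close> replaces those values.\<close>
  define B where "B s = (if s \<in> J then Bs s else UNIV) \<inter> (if s \<in> J' then Bs' s else UNIV)" for s
  have "cylinder J Bs \<inter> cylinder J' Bs' = cylinder (J \<union> J') B"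
    by (auto simp: cylinder_def B_def)
  moreover have "B s \<in> sets borel" for s using * by (auto simp: B_def)
  ultimately show "\<exists>J'' Bs''. cylinder J Bs \<inter> cylinder J' Bs' = cylinder J'' Bs'' \<and> finite J'' \<and> J'' \<subseteq> I \<and>
      (\<forall>s. Bs'' s \<in> sets borel)"
    using * by (intro exI[of _ "J \<union> J'"] exI[of _ B]) auto
qed

text \<open>The hypotheses control \<open>P r x\<close> only on events of the process, so kernel
  measurability needs the smaller sigma algebra generated after \<open>t\<close>. The starting time
  may lie strictly before \<open>t\<close>.\<close>

definition future_law :: "real \<Rightarrow> real \<times> 's \<Rightarrow> 'w measure" where
  "future_law t = (\<lambda>(r, x). restr_to_subalg (P r x) (future t))"

lemma subalgebra_P_future: "r \<in> {0..T} \<Longrightarrow> 0 \<le> t \<Longrightarrow> subalgebra (P r x) (future t)"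
  using subalgebra_P subalgebra_natural_sigma by auto

lemma sets_future_law: "r \<in> {0..T} \<Longrightarrow> 0 \<le> t \<Longrightarrow> sets (future_law t (r, x)) = sets (future t)"
  by (simp add: future_law_def sets_restr_to_subalg[OF subalgebra_P_future])

lemma emeasure_future_law:
  "r \<in> {0..T} \<Longrightarrow> 0 \<le> t \<Longrightarrow> A \<in> sets (future t) \<Longrightarrow> emeasure (future_law t (r, x)) A = emeasure (P r x) A"
  by (simp add: future_law_def emeasure_restr_to_subalg[OF subalgebra_P_future])

lemma prob_space_future_law: "r \<in> {0..T} \<Longrightarrow> 0 \<le> t \<Longrightarrow> prob_space (future_law t (r, x))"
  unfolding future_law_def by (simp add: prob_space_restr_to_subalg[OF subalgebra_P_future prob])

lemma integral_future_law:
  fixes Y :: "'w \<Rightarrow> 'b::{banach, second_countable_topology}"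
  assumes "r \<in> {0..T}" "0 \<le> t" "Y \<in> borel_measurable (future t)"
  shows "(LINT \<omega>|future_law t (r, x). Y \<omega>) = (LINT \<omega>|P r x. Y \<omega>)"
  unfolding future_law_def using integral_subalgebra2[OF subalgebra_P_future[OF assms(1,2)] assms(3)] by simp

text \<open>On the generating cylinders this is the first half of \<open>markov_cylinder\<close>;
  stability under intersection carries it to all events of the future.\<close>

lemma future_law_measurable:
  assumes "0 \<le> t" "t \<le> T"
  shows "future_law t \<in> slab t \<rightarrow>\<^sub>M subprob_algebra (future t)"
proof (rule measurable_subprob_algebra_generated[OF sets_natural_sigma_cylinders Int_stable_cylinders])
  have slabD: "\<exists>r x. p = (r, x) \<and> r \<in> {0..T}" if "p \<in> space (slab t)" for p
    using that assms by auto
  show "{cylinder J Bs | J Bs. finite J \<and> J \<subseteq> {t..T} \<and> (\<forall>s. Bs s \<in> sets borel)} \<subseteq> Pow (space M)"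
    by (auto simp: cylinder_def)
  show "subprob_space (future_law t p)" "sets (future_law t p) = sets (future t)"
    if "p \<in> space (slab t)" for p
    using slabD[OF that] assms prob_space_future_law sets_future_law
    by (auto intro: prob_space_imp_subprob_space)
  have cyl: "(\<lambda>p. emeasure (future_law t p) (cylinder J Bs)) \<in> borel_measurable (slab t)"
    if "finite J" "J \<subseteq> {t..T}" "\<forall>s. Bs s \<in> sets borel" for J Bs
  proof (subst measurable_cong)
    have "cylinder J Bs \<in> sets (future t)" using that by (intro cylinder_sets_natural_sigma) auto
    then show "emeasure (future_law t p) (cylinder J Bs) = (case p of (r, x) \<Rightarrow> emeasure (P r x) (cylinder J Bs))"
      if "p \<in> space (slab t)" for p
      using slabD[OF that] emeasure_future_law assms by auto
    show "(\<lambda>(r, x). emeasure (P r x) (cylinder J Bs)) \<in> borel_measurable (slab t)"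
      using markov_cylinder[of J t Bs] that assms by blast
  qed
  show "(\<lambda>p. emeasure (future_law t p) A) \<in> borel_measurable (slab t)"
    if "A \<in> {cylinder J Bs | J Bs. finite J \<and> J \<subseteq> {t..T} \<and> (\<forall>s. Bs s \<in> sets borel)}" for A
    using that cyl by blast
  have "cylinder {} (\<lambda>_. UNIV) = space M" by (simp add: cylinder_def)
  then show "(\<lambda>p. emeasure (future_law t p) (space M)) \<in> borel_measurable (slab t)"
    using cyl[of "{}" "\<lambda>_. UNIV"] by simp
qed

lemma future_law_state_measurable:
  assumes "0 \<le> r" "r \<le> t" "t \<le> T"
  shows "(\<lambda>\<omega>. future_law t (t, X t \<omega>)) \<in> P r x \<rightarrow>\<^sub>M subprob_algebra (future t)"
proof -
  have "(\<lambda>y. future_law t (t, y)) \<in> borel \<rightarrow>\<^sub>M subprob_algebra (future t)"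
    by (rule measurable_compose[OF measurable_Pair_slab future_law_measurable]) (use assms in auto)
  from measurable_compose[OF measurable_X_P this] show ?thesis using assms by auto
qed

text \<open>Two finite measures that agree on the cylinders coincide. Agreement there is
  \<open>markov_cylinder\<close> with the whole space as the weight; general weights were only
  required to run that induction.\<close>

lemma future_law_bind:
  assumes "0 \<le> r" "r \<le> t" "t \<le> T"
  shows "future_law t (r, x) = P r x \<bind> (\<lambda>\<omega>. future_law t (t, X t \<omega>))"
proof -
  have r: "r \<in> {0..T}" and t: "t \<in> {0..T}" using assms by auto
  interpret prob_space "P r x" using prob r by simp
  let ?G = "{cylinder J Bs | J Bs. finite J \<and> J \<subseteq> {t..T} \<and> (\<forall>s. Bs s \<in> sets borel)}"
  let ?K = "\<lambda>\<omega>. future_law t (t, X t \<omega>)"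
  have K: "?K \<in> P r x \<rightarrow>\<^sub>M subprob_algebra (future t)" by (rule future_law_state_measurable[OF assms])
  show ?thesis
  proof (rule measure_eqI_generator_eq[OF Int_stable_cylinders[of "{t..T}"], where \<Omega> = "space M" and A = "\<lambda>_. space M"])
    show "?G \<subseteq> Pow (space M)" by (auto simp: cylinder_def)
    show "sets (future_law t (r, x)) = sigma_sets (space M) ?G"
      using sets_future_law[OF r] t sets_natural_sigma_cylinders by simp
    show "sets (P r x \<bind> ?K) = sigma_sets (space M) ?G"
      using sets_bind[OF sets_kernel[OF K] not_empty] sets_natural_sigma_cylinders by simp
    show "range (\<lambda>_::nat. space M) \<subseteq> ?G"
    proof -
      have "cylinder {} (\<lambda>_. UNIV) = space M" by (simp add: cylinder_def)
      then show ?thesis by force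
    qed
    show "emeasure (future_law t (r, x)) (space M) \<noteq> \<infinity>"
      using prob_space_future_law[OF r, of t x] t
      by (simp add: prob_space_def finite_measure.emeasure_finite)
    fix A assume "A \<in> ?G"
    then obtain J Bs where A: "A = cylinder J Bs" "finite J" "J \<subseteq> {t..T}" "\<forall>s. Bs s \<in> sets borel" by blast
    have As: "A \<in> sets (future t)" unfolding A by (rule cylinder_sets_natural_sigma) (use A in auto)
    have sp: "space M \<in> sets (F t)" using filtration_sub[OF t] by (metis sets.top subalgebra_def)
    have "emeasure (P r x) (space M \<inter> A) = (\<integral>\<^sup>+\<omega>. indicator (space M) \<omega> * emeasure (P t (X t \<omega>)) A \<partial>P r x)"
      using markov_cylinder[of J t Bs] A t assms sp by auto
    also have "\<dots> = (\<integral>\<^sup>+\<omega>. emeasure (?K \<omega>) A \<partial>P r x)"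
      using t by (intro nn_integral_cong) (simp add: space_P[OF r] emeasure_future_law As)
    also have "\<dots> = emeasure (P r x \<bind> ?K) A"
      by (rule emeasure_bind[symmetric, OF not_empty K As])
    also have "space M \<inter> A = A" using A by (auto simp: cylinder_def)
    finally show "emeasure (future_law t (r, x)) A = emeasure (P r x \<bind> ?K) A"
      using emeasure_future_law[OF r _ As] t by simp
  qed auto
qed

lemma expectation_measurable:
  fixes Y :: "'w \<Rightarrow> 'b::{banach, second_countable_topology}"
  assumes "0 \<le> t" "t \<le> T" "Y \<in> borel_measurable (future t)"
  shows "(\<lambda>(r, x). LINT \<omega>|P r x. Y \<omega>) \<in> borel_measurable (slab t)"
proof (subst measurable_cong)
  show "(\<lambda>p. integral\<^sup>L (future_law t p) Y) \<in> borel_measurable (slab t)"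
    by (rule measurable_compose[OF future_law_measurable integral_measurable_subprob_algebra]) (use assms in auto)
  show "(case p of (r, x) \<Rightarrow> LINT \<omega>|P r x. Y \<omega>) = integral\<^sup>L (future_law t p) Y" if "p \<in> space (slab t)" for p
    using that integral_future_law[OF _ assms(1,3)] assms by auto
qed

lemma bounded_integrable_P:
  fixes Y :: "'w \<Rightarrow> 'b::{banach, second_countable_topology}"
  assumes "r \<in> {0..T}" "Y \<in> borel_measurable M" "\<And>\<omega>. \<omega> \<in> space M \<Longrightarrow> norm (Y \<omega>) \<le> C"
  shows "integrable (P r x) Y"
proof -
  interpret prob_space "P r x" using prob assms by simp
  show ?thesis
    by (rule integrable_const_bound[where B = C]) (use assms measurable_P[OF assms(1)] space_P[OF assms(1)] in auto)
qed

lemma norm_expectation_le: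
  fixes Y :: "'w \<Rightarrow> 'b::{banach, second_countable_topology}"
  assumes "r \<in> {0..T}" "\<And>\<omega>. \<omega> \<in> space M \<Longrightarrow> norm (Y \<omega>) \<le> C"
  shows "norm (LINT \<omega>|P r x. Y \<omega>) \<le> C"
proof -
  interpret prob_space "P r x" using prob assms by simp
  \<comment> \<open>A non-integrable \<open>Y\<close> has integral \<open>0\<close> by convention,
    and that case obeys the bound because \<open>C\<close> is nonnegative on a nonempty
    space.\<close>
  obtain \<omega> where "\<omega> \<in> space M" using not_empty space_P[OF assms(1), of x] by auto
  then have C: "0 \<le> C" using assms(2)[of \<omega>] norm_ge_zero[of "Y \<omega>"] by linarith
  show ?thesis
  proof (cases "integrable (P r x) Y")
    case True
    have "norm (LINT \<omega>|P r x. Y \<omega>) \<le> (LINT \<omega>|P r x. norm (Y \<omega>))" by (rule integral_norm_bound)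
    also have "\<dots> \<le> C"
      using True assms space_P by (intro integral_le_const) auto
    finally show ?thesis .
  qed (simp add: not_integrable_integral_eq C)
qed

lemma expectation_markov:
  fixes Y :: "'w \<Rightarrow> 'b::euclidean_space"
  assumes "0 \<le> r" "r \<le> t" "t \<le> T" and Y: "Y \<in> borel_measurable (future t)"
    and C: "\<And>\<omega>. \<omega> \<in> space M \<Longrightarrow> norm (Y \<omega>) \<le> C"
  shows "(LINT \<omega>|P r x. (LINT \<omega>'|P t (X t \<omega>). Y \<omega>')) = (LINT \<omega>|P r x. Y \<omega>)"
proof -
  have r: "r \<in> {0..T}" and t: "t \<in> {0..T}" using assms by auto
  interpret prob_space "P r x" using prob r by simp
  have YM: "Y \<in> borel_measurable M"
    using measurable_from_subalg[OF subalgebra_natural_sigma Y] t by auto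
  let ?K = "\<lambda>\<omega>. future_law t (t, X t \<omega>)"
  have K: "?K \<in> P r x \<rightarrow>\<^sub>M subprob_algebra (future t)" by (rule future_law_state_measurable[OF assms(1-3)])
  have "(\<lambda>y. LINT \<omega>'|P t y. Y \<omega>') \<in> borel_measurable borel"
    using measurable_compose[OF measurable_Pair_slab expectation_measurable[of t Y]] t Y by auto
  then have EM: "(\<lambda>\<omega>. LINT \<omega>'|P t (X t \<omega>). Y \<omega>') \<in> borel_measurable M"
    using measurable_compose[OF measurable_X[OF t]] by auto
  have intE: "integrable (P r x) (\<lambda>\<omega>. LINT \<omega>'|P t (X t \<omega>). Y \<omega>')"
    by (rule bounded_integrable_P[OF r EM]) (rule norm_expectation_le[OF t C])
  have intY: "integrable (P s y) Y" if "s \<in> {0..T}" for s y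
    by (rule bounded_integrable_P[OF that YM C])
  show ?thesis
  \<comment> \<open>The bind identity is applied to each real coordinate, which inherits the bound
    \<open>C\<close>.\<close>
  proof (rule euclidean_eqI)
    fix b :: 'b assume b: "b \<in> Basis"
    have Yb: "(\<lambda>\<omega>. Y \<omega> \<bullet> b) \<in> borel_measurable (future t)" using Y by simp
    have "(LINT \<omega>|P r x. Y \<omega> \<bullet> b) = (LINT \<omega>|future_law t (r, x). Y \<omega> \<bullet> b)"
      using integral_future_law[OF r _ Yb] t by simp
    also have "\<dots> = (LINT \<omega>|P r x. (LINT \<omega>'|?K \<omega>. Y \<omega>' \<bullet> b))"
      unfolding future_law_bind[OF assms(1-3)]
    proof (rule integral_bind[where B = C and B' = 1, OF Yb _ K])
      show "\<bar>Y \<omega> \<bullet> b\<bar> \<le> C" if "\<omega> \<in> space (future t)" for \<omega>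
        using Cauchy_Schwarz_ineq2[of "Y \<omega>" b] C[of \<omega>] that b by simp
      show "finite_measure (P r x)" by unfold_locales
      show "AE \<omega> in P r x. emeasure (?K \<omega>) (space (?K \<omega>)) \<le> ennreal 1"
        using prob_space.emeasure_space_1[OF prob_space_future_law[OF t]] t by simp
    qed
    also have "\<dots> = (LINT \<omega>|P r x. (LINT \<omega>'|P t (X t \<omega>). Y \<omega>') \<bullet> b)"
      using integral_future_law[OF t _ Yb] t intY[OF t] by simp
    finally show "(LINT \<omega>|P r x. (LINT \<omega>'|P t (X t \<omega>). Y \<omega>')) \<bullet> b = (LINT \<omega>|P r x. Y \<omega>) \<bullet> b"
      using intE intY[OF r] by simp
  qed
qed

end

section \<open>Integration against an atomless measure in time\<close>

text \<open>\<open>m\<close> need not be \<open>\<sigma>\<close>-finite, but the measure with density \<open>\<bar>h\<bar>\<close> is finite.\<close>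

lemma borel_measurable_dominated_lebesgue_integral:
  fixes \<Phi> :: "'a \<Rightarrow> 'w \<Rightarrow> 'b::{banach, second_countable_topology}"
  assumes \<Phi>: "(\<lambda>(s, \<omega>). \<Phi> s \<omega>) \<in> borel_measurable (m \<Otimes>\<^sub>M N)" and h: "integrable m h"
    and dom: "AE s in m. \<forall>\<omega>\<in>space N. norm (\<Phi> s \<omega>) \<le> h s"
  shows "(\<lambda>\<omega>. LINT s|m. \<Phi> s \<omega>) \<in> borel_measurable N"
proof -
  define k where "k s = \<bar>h s\<bar>" for s
  have k: "integrable m k" unfolding k_def using h by simp
  then have [measurable]: "k \<in> borel_measurable m" by auto
  have k_nonneg: "0 \<le> k s" for s by (simp add: k_def)
  let ?n = "density m (\<lambda>s. ennreal (k s))"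
  have "finite_measure ?n"
  proof (rule finite_measureI)
    have "emeasure ?n (space ?n) = (\<integral>\<^sup>+s. ennreal (k s) \<partial>m)"
      by (subst emeasure_density) (auto intro!: nn_integral_cong)
    also have "\<dots> = ennreal (LINT s|m. k s)"
      using k k_nonneg by (intro nn_integral_eq_integral) auto
    finally show "emeasure ?n (space ?n) \<noteq> \<infinity>" by simp
  qed
  then interpret finite_measure ?n .
  note [measurable] = \<Phi>
  have "(\<lambda>(s, \<omega>). (1 / k s) *\<^sub>R \<Phi> s \<omega>) \<in> borel_measurable (m \<Otimes>\<^sub>M N)" by measurable
  then have "(\<lambda>(\<omega>, s). (1 / k s) *\<^sub>R \<Phi> s \<omega>) \<in> borel_measurable (N \<Otimes>\<^sub>M m)"
    by (rule measurable_pair_swap[of "\<lambda>(s, \<omega>). (1 / k s) *\<^sub>R \<Phi> s \<omega>", simplified case_prod_beta fst_conv snd_conv, folded case_prod_beta])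
  also have "borel_measurable (N \<Otimes>\<^sub>M m) = borel_measurable (N \<Otimes>\<^sub>M ?n)"
    by (intro measurable_cong_sets sets_pair_measure_cong) auto
  finally have "(\<lambda>\<omega>. LINT s|?n. (1 / k s) *\<^sub>R \<Phi> s \<omega>) \<in> borel_measurable N"
    by (rule borel_measurable_lebesgue_integral)
  moreover have "(LINT s|?n. (1 / k s) *\<^sub>R \<Phi> s \<omega>) = (LINT s|m. \<Phi> s \<omega>)" if \<omega>: "\<omega> \<in> space N" for \<omega>
  proof -
    have [measurable]: "(\<lambda>s. \<Phi> s \<omega>) \<in> borel_measurable m"
      using measurable_compose[OF measurable_Pair2'[OF \<omega>] \<Phi>] by simp
    have "(LINT s|?n. (1 / k s) *\<^sub>R \<Phi> s \<omega>) = (LINT s|m. k s *\<^sub>R ((1 / k s) *\<^sub>R \<Phi> s \<omega>))"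
      by (rule integral_density) (auto simp: k_nonneg)
    also have "\<dots> = (LINT s|m. \<Phi> s \<omega>)"
    proof (rule integral_cong_AE)
      show "AE s in m. k s *\<^sub>R ((1 / k s) *\<^sub>R \<Phi> s \<omega>) = \<Phi> s \<omega>"
        using dom
      proof eventually_elim
        case (elim s)
        then have "norm (\<Phi> s \<omega>) \<le> h s" using \<omega> by blast
        \<comment> \<open>Where \<open>h s = 0\<close> the bound forces
          \<open>\<Phi> s \<omega> = 0\<close>, so the convention \<open>1 / 0 = 0\<close> in the
          quotient does no harm.\<close>
        then show ?case by (cases "h s = 0") (auto simp: k_def)
      qed
    qed measurable
    finally show ?thesis .
  qed
  ultimately show ?thesis by (rule measurable_cong[THEN iffD1, rotated])
qed

locale atomless_time_measure =
  fixes T :: real and mu :: "real measure"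
  assumes T_pos: "0 < T" and sets_mu: "sets mu = sets (restrict_space borel {0..T})"
    and atomless_mu: "atomless mu"
begin

lemma space_mu: "space mu = {0..T}"
  using sets_eq_imp_space_eq[OF sets_mu] by (simp add: space_restrict_space)

lemma sets_mu_Int: "A \<in> sets borel \<Longrightarrow> A \<inter> {0..T} \<in> sets mu"
  by (auto simp: sets_mu sets_restrict_space)

lemma sets_mu_subset: "A \<in> sets borel \<Longrightarrow> A \<subseteq> {0..T} \<Longrightarrow> A \<in> sets mu"
  using sets_mu_Int[of A] by (simp add: Int_absorb2)

text \<open>The only subsets of a singleton are itself and the empty set, so neither can carry a
  smaller positive mass. Atomlessness enters in this form alone.\<close>

lemma AE_neq: "AE s in mu. s \<noteq> c"
proof (cases "c \<in> {0..T}")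
  case True
  then have c: "{c} \<in> sets mu" by (intro sets_mu_subset) auto
  have "emeasure mu {c} = 0"
  proof (rule ccontr)
    assume "emeasure mu {c} \<noteq> 0"
    then have "0 < emeasure mu {c}" by (simp add: zero_less_iff_neq_zero)
    then obtain B where B: "B \<subseteq> {c}" "0 < emeasure mu B" "emeasure mu B < emeasure mu {c}"
      using atomless_mu c unfolding atomless_def by blast
    then consider "B = {}" | "B = {c}" by blast
    then show False using B by cases auto
  qed
  then show ?thesis
    using c by (intro AE_I[of _ _ "{c}"]) auto
next
  case False
  then show ?thesis by (intro AE_I2) (auto simp: space_mu)
qed

lemma borel_measurable_mu:
  assumes "f \<in> borel_measurable borel"
  shows "f \<in> borel_measurable mu"
  unfolding measurable_cong_sets[OF sets_mu HOL.refl] by (rule measurable_restrict_space1[OF assms])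

lemma indicator_scaleR_measurable:
  fixes f :: "real \<Rightarrow> 'b::{banach, second_countable_topology}"
  assumes "f \<in> borel_measurable mu" "A \<in> sets borel"
  shows "(\<lambda>s. indicator A s *\<^sub>R f s) \<in> borel_measurable mu"
proof -
  have "(indicator A :: real \<Rightarrow> real) \<in> borel_measurable borel" using assms(2) by simp
  from borel_measurable_scaleR[OF borel_measurable_mu[OF this] assms(1)] show ?thesis .
qed

lemma integrable_imp_set_integrable:
  fixes f :: "real \<Rightarrow> 'b::{banach, second_countable_topology}"
  assumes "integrable mu f" "A \<in> sets borel"
  shows "set_integrable mu A f"
  unfolding set_integrable_def
proof (rule Bochner_Integration.integrable_bound[OF assms(1)])
  show "(\<lambda>s. indicator A s *\<^sub>R f s) \<in> borel_measurable mu"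
    using assms by (intro indicator_scaleR_measurable) auto
qed (auto simp: indicator_def)

lemma set_integral_split:
  fixes f :: "real \<Rightarrow> 'b::{banach, second_countable_topology}"
  assumes "integrable mu f" "0 \<le> r" "r \<le> t" "t \<le> T"
  shows "(LINT s:{r..T}|mu. f s) = (LINT s:{r..t}|mu. f s) + (LINT s:{t..T}|mu. f s)"
proof -
  have "{r..T} = {r..t} \<union> {t..T}" using assms by auto
  moreover have "(LINT s:{r..t} \<union> {t..T}|mu. f s) = (LINT s:{r..t}|mu. f s) + (LINT s:{t..T}|mu. f s)"
  proof (rule set_integral_Un_AE)
    \<comment> \<open>The two intervals overlap in the endpoint \<open>t\<close>, which is
      null.\<close>
    show "AE s in mu. \<not> (s \<in> {r..t} \<and> s \<in> {t..T})"
      using AE_neq[of t] by eventually_elim auto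
  qed (use assms in \<open>auto intro!: integrable_imp_set_integrable sets_mu_subset\<close>)
  ultimately show ?thesis by simp
qed

lemma set_integral_singleton_zero:
  fixes f :: "real \<Rightarrow> 'b::{banach, second_countable_topology}"
  shows "(LINT s:{t..t}|mu. f s) = 0"
proof -
  have "AE s in mu. indicator {t..t} s *\<^sub>R f s = 0"
    using AE_neq[of t] by eventually_elim auto
  then show ?thesis unfolding set_lebesgue_integral_def by (rule integral_eq_zero_AE)
qed

section \<open>Tail integrals and the exponential weight\<close>

definition tail_integral :: "(real \<Rightarrow> real) \<Rightarrow> real \<Rightarrow> real" where
  "tail_integral h r = (LINT s:{r..T}|mu. h s)"

text \<open>Away from the null point \<open>s = r\<close>, membership of \<open>s\<close> in
  \<open>{p n..T}\<close> is eventually constant in \<open>n\<close>, so dominated convergence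
  applies with \<open>norm (f s)\<close>.\<close>

lemma set_integral_tendsto:
  fixes f :: "real \<Rightarrow> 'b::{banach, second_countable_topology}"
  assumes f: "integrable mu f" and lim: "p \<longlonglongrightarrow> r"
  shows "(\<lambda>n. LINT s:{p n..T}|mu. f s) \<longlonglongrightarrow> (LINT s:{r..T}|mu. f s)"
  unfolding set_lebesgue_integral_def
proof (rule integral_dominated_convergence[where w = "\<lambda>s. norm (f s)"])
  show "AE s in mu. (\<lambda>n. indicator {p n..T} s *\<^sub>R f s) \<longlonglongrightarrow> indicator {r..T} s *\<^sub>R f s"
    using AE_neq[of r]
  proof eventually_elim
    case (elim s)
    have "\<forall>\<^sub>F n in sequentially. (p n \<le> s) = (r \<le> s)"
    proof (cases "r < s")
      case True
      then show ?thesis using order_tendstoD(2)[OF lim, of s] by (auto elim!: eventually_mono)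
    next
      case False
      then have "s < r" using elim by simp
      then show ?thesis using order_tendstoD(1)[OF lim, of s] by (auto elim!: eventually_mono)
    qed
    then have "\<forall>\<^sub>F n in sequentially. indicator {r..T} s *\<^sub>R f s = indicator {p n..T} s *\<^sub>R f s"
      by eventually_elim (simp add: indicator_def)
    then show ?case by (rule Lim_transform_eventually[OF tendsto_const])
  qed
  show "AE s in mu. norm (indicator {p n..T} s *\<^sub>R f s) \<le> norm (f s)" for n
    by (simp add: indicator_def)
qed (use f in \<open>auto intro!: indicator_scaleR_measurable\<close>)

lemma continuous_on_tail_integral:
  assumes "integrable mu h"
  shows "continuous_on A (tail_integral h)"
  unfolding continuous_on_sequentially tail_integral_def comp_def
  using set_integral_tendsto[OF assms] by blast

lemma tail_integral_T: "tail_integral h T = 0"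
  unfolding tail_integral_def by (rule set_integral_singleton_zero)

lemma set_integral_nonneg_mu:
  assumes "\<And>s. s \<in> {0..T} \<Longrightarrow> 0 \<le> f s"
  shows "0 \<le> (LINT s:A|mu. f s :: real)"
  unfolding set_lebesgue_integral_def
  by (rule integral_nonneg_AE, rule AE_I2) (use assms in \<open>auto simp: space_mu\<close>)

text \<open>The weight \<open>exp (6 * tail_integral h s)\<close> makes integration against \<open>h\<close> a contraction
  with factor \<open>1 / 2\<close>; the sharp constant \<open>1 / 6\<close> is not needed.\<close>

context
  fixes h :: "real \<Rightarrow> real"
  assumes h: "integrable mu h" and h_nonneg: "\<And>s. s \<in> {0..T} \<Longrightarrow> 0 \<le> h s"
begin

abbreviation (input) H where "H \<equiv> tail_integral h"

lemma tail_integral_nonneg: "0 \<le> H r"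
  unfolding tail_integral_def by (rule set_integral_nonneg_mu[OF h_nonneg])

lemma tail_integral_antimono: "0 \<le> r \<Longrightarrow> r \<le> t \<Longrightarrow> t \<le> T \<Longrightarrow> H t \<le> H r"
  using set_integral_split[OF h, of r t] set_integral_nonneg_mu[of h "{r..t}"] h_nonneg
  by (simp add: tail_integral_def)

lemma weight_integrable: "integrable mu (\<lambda>s. h s * exp (c * H s))"
proof (rule Bochner_Integration.integrable_bound)
  show "integrable mu (\<lambda>s. exp (\<bar>c\<bar> * H 0) * h s)" using h by simp
  have "H \<in> borel_measurable mu"
    by (rule borel_measurable_mu) (rule borel_measurable_continuous_onI[OF continuous_on_tail_integral[OF h]])
  then show "(\<lambda>s. h s * exp (c * H s)) \<in> borel_measurable mu" using h by simp
  show "AE s in mu. norm (h s * exp (c * H s)) \<le> norm (exp (\<bar>c\<bar> * H 0) * h s)"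
  proof (rule AE_I2)
    fix s assume s: "s \<in> space mu"
    have "c * H s \<le> \<bar>c\<bar> * H 0"
      using tail_integral_antimono[of 0 s] s tail_integral_nonneg[of s]
      by (intro mult_mono) (auto simp: space_mu)
    then show "norm (h s * exp (c * H s)) \<le> norm (exp (\<bar>c\<bar> * H 0) * h s)"
      using h_nonneg[of s] s by (auto simp: space_mu abs_mult mult.commute intro!: mult_left_mono)
  qed
qed

text \<open>A change of variables would give \<open>(exp (c * H r) - 1) / c\<close> exactly. Instead
  \<open>{r..T}\<close> is cut at the levels \<open>H = j / c\<close>; on each piece
  \<open>c * H\<close> varies by at most 1, so freezing the exponential at its maximum loses at most
  the factor \<open>exp 1\<close>, and the pieces telescope.\<close>

lemma exp_weight_aux:
  assumes "0 < c" "0 \<le> r" "r \<le> T" "H r \<le> real j / c"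
  shows "(LINT s:{r..T}|mu. h s * exp (c * H s)) \<le> exp 1 / c * (exp (c * H r) - 1)"
  using assms(2-)
proof (induct j arbitrary: r)
  case 0
  then have "H r = 0" using tail_integral_nonneg[of r] by simp
  have "(LINT s:{r..T}|mu. h s * exp (c * H s)) = (LINT s:{r..T}|mu. h s)"
  proof (rule set_lebesgue_integral_cong)
    show "{r..T} \<in> sets mu" using 0 by (intro sets_mu_subset) auto
    have "H s = 0" if "s \<in> {r..T}" for s
      using tail_integral_antimono[of r s] tail_integral_nonneg[of s] that 0 \<open>H r = 0\<close> by auto
    then show "\<forall>s. s \<in> {r..T} \<longrightarrow> h s * exp (c * H s) = h s" by simp
  qed
  then show ?case using \<open>H r = 0\<close> by (simp add: tail_integral_def)
next
  case (Suc j)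
  show ?case
  proof (cases "H r \<le> real j / c")
    case True
    then show ?thesis using Suc by blast
  next
    case False
    \<comment> \<open>\<open>H\<close> is continuous and falls to \<open>0\<close> at
      \<open>T\<close>, so it meets the next lower level.\<close>
    have "\<exists>t\<ge>r. t \<le> T \<and> H t = real j / c"
      by (rule IVT2') (use Suc False assms(1) continuous_on_tail_integral[OF h] in \<open>auto simp: tail_integral_T\<close>)
    then obtain t where t: "r \<le> t" "t \<le> T" "H t = real j / c" by blast
    let ?f = "\<lambda>s. h s * exp (c * H s)"
    have "(LINT s:{r..t}|mu. ?f s) \<le> (LINT s:{r..t}|mu. exp (c * H r) * h s)"
    proof (rule set_integral_mono)
      show "set_integrable mu {r..t} ?f"
        by (rule integrable_imp_set_integrable[OF weight_integrable]) simp
      show "set_integrable mu {r..t} (\<lambda>s. exp (c * H r) * h s)"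
        by (rule integrable_imp_set_integrable) (use h in auto)
      show "?f s \<le> exp (c * H r) * h s" if "s \<in> {r..t}" for s
        using tail_integral_antimono[of r s] h_nonneg[of s] that t Suc assms(1)
        by (auto simp: mult.commute intro!: mult_left_mono)
    qed
    also have "\<dots> = exp (c * H r) * (H r - H t)"
      using set_integral_split[OF h, of r t] t Suc by (simp add: tail_integral_def)
    also have "\<dots> \<le> exp 1 / c * (exp (c * H r) - exp (c * H t))"
    proof -
      define z where "z = c * (H r - H t)"
      have z: "0 \<le> z" "z \<le> 1" "c * H r = c * H t + z"
        using tail_integral_antimono[of r t] t Suc assms(1) by (auto simp: z_def field_simps)
      have "z \<le> exp z - 1"
        using exp_ge_add_one_self[of z] by linarith
      then have "exp z * z \<le> exp 1 * (exp z - 1)"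
        using z by (intro mult_mono) auto
      then have "exp (c * H t) * (exp z * z) \<le> exp (c * H t) * (exp 1 * (exp z - 1))"
        by (intro mult_left_mono) auto
      then have "exp (c * H r) * z \<le> exp 1 * (exp (c * H r) - exp (c * H t))"
        unfolding z(3) exp_add by (simp add: algebra_simps)
      then show ?thesis using assms(1) by (simp add: z_def field_simps)
    qed
    finally have 1: "(LINT s:{r..t}|mu. ?f s) \<le> exp 1 / c * (exp (c * H r) - exp (c * H t))" .
    have 2: "(LINT s:{t..T}|mu. ?f s) \<le> exp 1 / c * (exp (c * H t) - 1)"
      using Suc t by (intro Suc.hyps) auto
    show ?thesis
      using set_integral_split[OF weight_integrable[of c], of r t] 1 2 t Suc
      by (simp add: right_diff_distrib)
  qed
qed

text \<open>The rate 6 makes the constant \<open>exp 1 / 6\<close> from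
  \<open>exp_weight_aux\<close> at most \<open>1 / 2\<close>, because
  \<open>exp 1 \<le> 3\<close>.\<close>

definition weight :: "real \<Rightarrow> real" where "weight s = exp (6 * H s)"

lemma weight_ge_1: "1 \<le> weight s"
  using tail_integral_nonneg[of s] by (simp add: weight_def)

lemma weight_le: "s \<in> {0..T} \<Longrightarrow> weight s \<le> weight 0"
  using tail_integral_antimono[of 0 s] by (auto simp: weight_def)

lemma integrable_times_weight: "integrable mu (\<lambda>s. h s * weight s)"
  unfolding weight_def by (rule weight_integrable)

lemma weight_contraction:
  assumes "0 \<le> r" "r \<le> T"
  shows "(LINT s:{r..T}|mu. h s * weight s) \<le> weight r / 2"
proof -
  obtain j :: nat where j: "6 * H r \<le> real j" using real_arch_simple by blast
  have "(LINT s:{r..T}|mu. h s * exp (6 * H s)) \<le> exp 1 / 6 * (exp (6 * H r) - 1)"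
    using j assms by (intro exp_weight_aux[of 6 r j]) auto
  also have "\<dots> \<le> 3 / 6 * exp (6 * H r)"
    using exp_le tail_integral_nonneg[of r] by (intro mult_mono) auto
  finally show ?thesis by (simp add: weight_def)
qed

end

end

section \<open>Path integrals and their expectations\<close>

locale markov_time_integral =
  progressive_markov_pseudometric T d M X F P + atomless_time_measure T mu
  for T :: real and d :: "real \<times> 's::topological_space \<Rightarrow> real \<times> 's \<Rightarrow> real"
    and M :: "'w measure" and X F and P :: "real \<Rightarrow> 's \<Rightarrow> 'w measure" and mu :: "real measure"
begin

text \<open>The bound is uniform in the state \<open>y\<close>, so one null set of times and one
  function \<open>h\<close> serve along every path.\<close>

definition dominated :: "(real \<Rightarrow> 's \<Rightarrow> 'b::euclidean_space) \<Rightarrow> bool" where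
  "dominated \<phi> \<longleftrightarrow> (\<lambda>(s, y). \<phi> s y) \<in> borel_measurable BTS \<and>
    (\<exists>h. integrable mu h \<and> (AE s in mu. \<forall>y. norm (\<phi> s y) \<le> h s))"

lemma dominatedI:
  assumes "(\<lambda>(s, y). \<phi> s y) \<in> borel_measurable BTS" "integrable mu h" "AE s in mu. \<forall>y. norm (\<phi> s y) \<le> h s"
  shows "dominated \<phi>"
  using assms unfolding dominated_def by blast

lemma dominated_diff:
  assumes "dominated \<phi>" "dominated \<psi>"
  shows "dominated (\<lambda>s y. \<phi> s y - \<psi> s y)"
proof -
  obtain h k where *: "integrable mu h" "AE s in mu. \<forall>y. norm (\<phi> s y) \<le> h s"
    "integrable mu k" "AE s in mu. \<forall>y. norm (\<psi> s y) \<le> k s"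
    using assms unfolding dominated_def by blast
  show ?thesis
  proof (rule dominatedI[where h = "\<lambda>s. h s + k s"])
    have "(\<lambda>p. (case p of (s, y) \<Rightarrow> \<phi> s y) - (case p of (s, y) \<Rightarrow> \<psi> s y)) \<in> borel_measurable BTS"
      by (rule borel_measurable_diff) (use assms in \<open>auto simp: dominated_def\<close>)
    then show "(\<lambda>(s, y). \<phi> s y - \<psi> s y) \<in> borel_measurable BTS" by (simp add: case_prod_beta)
    show "AE s in mu. \<forall>y. norm (\<phi> s y - \<psi> s y) \<le> h s + k s"
      using *(2,4)
    proof eventually_elim
      case (elim s)
      then show ?case using norm_triangle_ineq4 by (meson add_mono order_trans)
    qed
  qed (use * in auto)
qed

lemma dominated_norm:
  assumes "dominated \<phi>"
  shows "dominated (\<lambda>s y. norm (\<phi> s y))"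
proof -
  obtain h where h: "integrable mu h" "AE s in mu. \<forall>y. norm (\<phi> s y) \<le> h s"
    using assms unfolding dominated_def by blast
  have "(\<lambda>(s, y). \<phi> s y) \<in> borel_measurable BTS" using assms by (auto simp: dominated_def)
  from measurable_compose[OF this, of norm borel]
  have "(\<lambda>(s, y). norm (\<phi> s y)) \<in> borel_measurable BTS" by (simp add: case_prod_beta)
  then show ?thesis by (rule dominatedI[OF _ h(1)]) (use h(2) in simp)
qed

lemma dominated_indicator:
  assumes "dominated \<phi>" "I \<in> sets borel"
  shows "dominated (\<lambda>s y. indicator I s *\<^sub>R \<phi> s y)"
proof -
  obtain h where h: "integrable mu h" "AE s in mu. \<forall>y. norm (\<phi> s y) \<le> h s"
    using assms unfolding dominated_def by blast
  have "(\<lambda>p. indicator I (fst p) *\<^sub>R (case p of (s, y) \<Rightarrow> \<phi> s y)) \<in> borel_measurable BTS"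
  proof (rule borel_measurable_scaleR)
    have "(indicator I :: real \<Rightarrow> real) \<in> borel_measurable borel" using assms(2) by simp
    from measurable_compose[OF fst_measurable this]
    show "(\<lambda>p. indicator I (fst p) :: real) \<in> borel_measurable BTS" .
  qed (use assms in \<open>auto simp: dominated_def\<close>)
  then have "(\<lambda>(s, y). indicator I s *\<^sub>R \<phi> s y) \<in> borel_measurable BTS" by (simp add: case_prod_beta)
  then show ?thesis
  proof (rule dominatedI)
    show "integrable mu (\<lambda>s. \<bar>h s\<bar>)" using h by simp
    show "AE s in mu. \<forall>y. norm (indicator I s *\<^sub>R \<phi> s y) \<le> \<bar>h s\<bar>"
      using h(2)
    proof eventually_elim
      case (elim s)
      then have "norm (\<phi> s y) \<le> \<bar>h s\<bar>" for y using abs_ge_self[of "h s"] order_trans by blast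
      then show ?case by (simp add: indicator_def)
    qed
  qed
qed

lemma sets_restrict_mu:
  assumes "J \<subseteq> {0..T}"
  shows "sets (restrict_space mu J) = sets (restrict_space borel J)"
proof -
  have "(\<inter>) J ` (\<inter>) {0..T} ` S = (\<inter>) J ` S" for S
    using assms unfolding image_image by (intro image_cong) auto
  then show ?thesis by (simp add: sets_restrict_space sets_mu)
qed

text \<open>The backward form of progressive measurability yields the sigma algebra of the future of
  \<open>t\<close> in place of all of \<open>M\<close>; the Markov property needs the smaller
  one.\<close>

lemma path_jointly_measurable:
  assumes "(\<lambda>(s, y). \<phi> s y) \<in> borel_measurable BTS" "0 \<le> t" "t \<le> T"
  shows "(\<lambda>(s, \<omega>). \<phi> s (X s \<omega>)) \<in> borel_measurable (restrict_space mu {t..T} \<Otimes>\<^sub>M future t)"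
proof -
  have "(\<lambda>(s, \<omega>). (s, X s \<omega>)) \<in> restrict_space borel {t..T} \<Otimes>\<^sub>M future t \<rightarrow>\<^sub>M BTS"
    by (rule measurable_time_Pair[OF second_countable_state _ backward_progressive]) (use assms in auto)
  from measurable_compose[OF this assms(1)]
  have "(\<lambda>(s, \<omega>). \<phi> s (X s \<omega>)) \<in> borel_measurable (restrict_space borel {t..T} \<Otimes>\<^sub>M future t)"
    by (simp add: case_prod_beta)
  moreover have "sets (restrict_space mu {t..T} \<Otimes>\<^sub>M future t) = sets (restrict_space borel {t..T} \<Otimes>\<^sub>M future t)"
    by (intro sets_pair_measure_cong sets_restrict_mu) (use assms in auto)
  ultimately show ?thesis
    unfolding measurable_cong_sets[OF \<open>sets (restrict_space mu {t..T} \<Otimes>\<^sub>M future t) = _\<close> HOL.refl] by simp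
qed

lemma path_integrable:
  assumes "dominated \<phi>" "\<omega> \<in> space M"
  shows "integrable mu (\<lambda>s. \<phi> s (X s \<omega>))"
proof -
  obtain h where h: "integrable mu h" "AE s in mu. \<forall>y. norm (\<phi> s y) \<le> h s"
    and \<phi>: "(\<lambda>(s, y). \<phi> s y) \<in> borel_measurable BTS"
    using assms unfolding dominated_def by blast
  have "(\<lambda>s. (s, \<omega>)) \<in> restrict_space mu {0..T} \<rightarrow>\<^sub>M restrict_space mu {0..T} \<Otimes>\<^sub>M future 0"
    by (rule measurable_Pair2') (use assms in simp)
  from measurable_compose[OF this path_jointly_measurable[OF \<phi>]] T_pos
  have "(\<lambda>s. \<phi> s (X s \<omega>)) \<in> borel_measurable (restrict_space mu {0..T})" by simp
  moreover have "sets (restrict_space mu {0..T}) = sets mu" using sets_restrict_mu[of "{0..T}"] sets_mu by simp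
  ultimately have "(\<lambda>s. \<phi> s (X s \<omega>)) \<in> borel_measurable mu"
    by (metis measurable_cong_sets HOL.refl)
  then show ?thesis
  proof (rule Bochner_Integration.integrable_bound[OF h(1)])
    show "AE s in mu. norm (\<phi> s (X s \<omega>)) \<le> norm (h s)"
      using h(2)
    proof eventually_elim
      case (elim s)
      then have "norm (\<phi> s (X s \<omega>)) \<le> h s" by blast
      then show ?case by simp
    qed
  qed
qed

lemma path_set_integrable:
  assumes "dominated \<phi>" "\<omega> \<in> space M" "I \<in> sets borel"
  shows "set_integrable mu I (\<lambda>s. \<phi> s (X s \<omega>))"
  by (rule integrable_imp_set_integrable[OF path_integrable]) (use assms in auto)

lemma norm_path_integral_le:
  assumes "dominated \<phi>" "\<omega> \<in> space M" "I \<in> sets borel" "integrable mu k"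
    and "AE s in mu. s \<in> I \<longrightarrow> norm (\<phi> s (X s \<omega>)) \<le> k s"
  shows "norm (LINT s:I|mu. \<phi> s (X s \<omega>)) \<le> (LINT s:I|mu. k s)"
proof -
  have "norm (LINT s:I|mu. \<phi> s (X s \<omega>)) \<le> (LINT s:I|mu. norm (\<phi> s (X s \<omega>)))"
    by (rule set_integral_norm_bound[OF path_set_integrable[OF assms(1-3)]])
  also have "\<dots> \<le> (LINT s:I|mu. k s)"
  proof (rule set_integral_mono_AE)
    show "set_integrable mu I (\<lambda>s. norm (\<phi> s (X s \<omega>)))"
      by (rule path_set_integrable[OF dominated_norm[OF assms(1)] assms(2,3)])
    show "set_integrable mu I k" by (rule integrable_imp_set_integrable[OF assms(4,3)])
  qed (use assms(5) in simp)
  finally show ?thesis .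
qed

text \<open>The dominating function does not see the path, so its total integral bounds all path
  integrals at once. This constant later dominates under every \<open>P r x\<close>.\<close>

lemma path_integral_bounded:
  assumes "dominated \<phi>"
  obtains C where "\<And>I \<omega>. I \<in> sets borel \<Longrightarrow> \<omega> \<in> space M \<Longrightarrow> norm (LINT s:I|mu. \<phi> s (X s \<omega>)) \<le> C"
proof -
  obtain h where h: "integrable mu h" "AE s in mu. \<forall>y. norm (\<phi> s y) \<le> h s"
    using assms unfolding dominated_def by blast
  have "norm (LINT s:I|mu. \<phi> s (X s \<omega>)) \<le> (LINT s|mu. \<bar>h s\<bar>)" if "I \<in> sets borel" "\<omega> \<in> space M" for I \<omega>
  proof -
    have "norm (LINT s:I|mu. \<phi> s (X s \<omega>)) \<le> (LINT s:I|mu. h s)"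
      by (rule norm_path_integral_le[OF assms that(2,1) h(1)]) (use h(2) in \<open>auto elim!: eventually_mono\<close>)
    also have "\<dots> \<le> (LINT s|mu. \<bar>h s\<bar>)"
      unfolding set_lebesgue_integral_def
      using integrable_imp_set_integrable[OF h(1) that(1)] h(1)
      by (intro integral_mono) (auto simp: set_integrable_def indicator_def)
    finally show ?thesis .
  qed
  then show ?thesis by (rule that)
qed

lemma path_integral_measurable:
  assumes "dominated \<phi>" "0 \<le> r" "r \<le> T"
  shows "(\<lambda>\<omega>. LINT s:{r..t}|mu. \<phi> s (X s \<omega>)) \<in> borel_measurable (future r)"
proof -
  \<comment> \<open>The upper limit moves into the integrand, since joint measurability with respect
    to \<open>future r\<close> is available on all of \<open>{r..T}\<close>.\<close>
  define \<psi> where "\<psi> = (\<lambda>s y. indicator {..t} s *\<^sub>R \<phi> s y)"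
  have dom: "dominated \<psi>" unfolding \<psi>_def by (rule dominated_indicator[OF assms(1)]) simp
  obtain h where h: "integrable mu h" "AE s in mu. \<forall>y. norm (\<psi> s y) \<le> h s"
    and \<psi>: "(\<lambda>(s, y). \<psi> s y) \<in> borel_measurable BTS"
    using dom unfolding dominated_def by blast
  have rT: "{r..T} \<inter> space mu \<in> sets mu" by (metis Int_commute Icc_borel sets_mu_Int space_mu inf_commute)
  have "(\<lambda>\<omega>. LINT s|restrict_space mu {r..T}. \<psi> s (X s \<omega>)) \<in> borel_measurable (future r)"
  proof (rule borel_measurable_dominated_lebesgue_integral[OF path_jointly_measurable[OF \<psi> assms(2,3)]])
    show "integrable (restrict_space mu {r..T}) h"
      unfolding integrable_restrict_space[OF rT]
      using integrable_imp_set_integrable[OF h(1), of "{r..T}"] by (simp add: set_integrable_def)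
    show "AE s in restrict_space mu {r..T}. \<forall>\<omega>\<in>space (future r). norm (\<psi> s (X s \<omega>)) \<le> h s"
      unfolding AE_restrict_space_iff[OF rT] using h(2) by eventually_elim auto
  qed
  moreover have "(LINT s|restrict_space mu {r..T}. \<psi> s (X s \<omega>)) = (LINT s:{r..t}|mu. \<phi> s (X s \<omega>))" for \<omega>
    unfolding integral_restrict_space[OF rT] set_lebesgue_integral_def
    by (rule Bochner_Integration.integral_cong) (auto simp: \<psi>_def indicator_def space_mu)
  ultimately show ?thesis by simp
qed

lemma path_integral_measurable_M:
  assumes "dominated \<phi>" "0 \<le> r" "r \<le> T"
  shows "(\<lambda>\<omega>. LINT s:{r..t}|mu. \<phi> s (X s \<omega>)) \<in> borel_measurable M"
  by (rule measurable_from_subalg[OF subalgebra_natural_sigma path_integral_measurable]) (use assms in auto)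

lemma path_integral_integrable:
  assumes "dominated \<phi>" "r \<in> {0..T}" "r' \<in> {0..T}"
  shows "integrable (P r' x) (\<lambda>\<omega>. LINT s:{r..t}|mu. \<phi> s (X s \<omega>))"
proof -
  obtain C where C: "\<And>I \<omega>. I \<in> sets borel \<Longrightarrow> \<omega> \<in> space M \<Longrightarrow> norm (LINT s:I|mu. \<phi> s (X s \<omega>)) \<le> C"
    by (rule path_integral_bounded[OF assms(1)]) blast
  show ?thesis
    by (rule bounded_integrable_P[OF assms(3) path_integral_measurable_M[OF assms(1)] C]) (use assms in auto)
qed

definition future_integral :: "(real \<Rightarrow> 's \<Rightarrow> 'b::euclidean_space) \<Rightarrow> real \<Rightarrow> 's \<Rightarrow> 'b" where
  "future_integral \<phi> r x = (LINT \<omega>|P r x. (LINT s:{r..T}|mu. \<phi> s (X s \<omega>)))"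

lemma future_integral_diff:
  assumes "dominated \<phi>" "dominated \<psi>" "r \<in> {0..T}"
  shows "future_integral \<phi> r x - future_integral \<psi> r x = future_integral (\<lambda>s y. \<phi> s y - \<psi> s y) r x"
proof -
  have "future_integral \<phi> r x - future_integral \<psi> r x =
      (LINT \<omega>|P r x. (LINT s:{r..T}|mu. \<phi> s (X s \<omega>)) - (LINT s:{r..T}|mu. \<psi> s (X s \<omega>)))"
    unfolding future_integral_def
    by (rule Bochner_Integration.integral_diff[symmetric]; rule path_integral_integrable) (use assms in auto)
  also have "\<dots> = future_integral (\<lambda>s y. \<phi> s y - \<psi> s y) r x"
    unfolding future_integral_def
    by (intro Bochner_Integration.integral_cong HOL.refl set_integral_diff(2)[symmetric] path_set_integrable)
      (use assms space_P in auto)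
  finally show ?thesis .
qed

text \<open>The estimate holds along each single path, so the factor \<open>1 / 2\<close> of
  \<open>weight_contraction\<close> survives the expectation. It serves both for growth, with the
  weight of \<open>h\<close>, and for differences, with the weight of a Lipschitz
  coefficient.\<close>

lemma norm_future_integral_le:
  assumes "dominated \<phi>" "r \<in> {0..T}" "integrable mu h" "\<And>s. s \<in> {0..T} \<Longrightarrow> 0 \<le> h s" "0 \<le> K"
    and "AE s in mu. r \<le> s \<longrightarrow> (\<forall>y. norm (\<phi> s y) \<le> K * (h s * weight h s))"
  shows "norm (future_integral \<phi> r x) \<le> K / 2 * weight h r"
  unfolding future_integral_def
proof (rule norm_expectation_le[OF assms(2)])
  fix \<omega> assume \<omega>: "\<omega> \<in> space M"
  have "norm (LINT s:{r..T}|mu. \<phi> s (X s \<omega>)) \<le> (LINT s:{r..T}|mu. K * (h s * weight h s))"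
  proof (rule norm_path_integral_le[OF assms(1) \<omega>])
    show "integrable mu (\<lambda>s. K * (h s * weight h s))"
      using integrable_times_weight[OF assms(3,4)] by simp
    show "AE s in mu. s \<in> {r..T} \<longrightarrow> norm (\<phi> s (X s \<omega>)) \<le> K * (h s * weight h s)"
      using assms(6) by eventually_elim auto
  qed simp
  also have "\<dots> \<le> K * (weight h r / 2)"
  proof -
    have "(LINT s:{r..T}|mu. K * (h s * weight h s)) = K * (LINT s:{r..T}|mu. h s * weight h s)" by simp
    also have "\<dots> \<le> K * (weight h r / 2)"
      using weight_contraction[OF assms(3,4), of r] assms(2,5) by (intro mult_left_mono) auto
    finally show ?thesis .
  qed
  finally show "norm (LINT s:{r..T}|mu. \<phi> s (X s \<omega>)) \<le> K / 2 * weight h r" by simp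
qed

text \<open>For fixed starting time \<open>t\<close> of the inner integral, the expectation is Borel in
  \<open>(r, x)\<close> with \<open>r \<le> t\<close>; the variable starting time \<open>r\<close> is approximated from above by grid
  points, where \<open>time_measurable\<close> makes the choice of the grid point Borel.\<close>

lemma future_integral_measurable:
  assumes "dominated \<phi>"
  shows "(\<lambda>(r, x). future_integral \<phi> r x) \<in> borel_measurable BTS"
proof -
  define Y where "Y t \<omega> = (LINT s:{t..T}|mu. \<phi> s (X s \<omega>))" for t \<omega>
  \<comment> \<open>For \<open>r\<close> in \<open>{0..T}\<close>, \<open>\<iota> n r\<close> is the
    least index whose grid point is not below \<open>r\<close>; the minimum with \<open>T\<close>
    keeps the grid inside the time horizon.\<close>
  define grid where "grid n i = min T (real i / real (Suc n))" for n i :: nat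
  define \<iota> where "\<iota> n r = nat \<lceil>r * real (Suc n)\<rceil>" for n :: nat and r :: real
  obtain C where C: "\<And>I \<omega>. I \<in> sets borel \<Longrightarrow> \<omega> \<in> space M \<Longrightarrow> norm (LINT s:I|mu. \<phi> s (X s \<omega>)) \<le> C"
    by (rule path_integral_bounded[OF assms]) blast
  have grid: "grid n i \<in> {0..T}" for n i using T_pos by (auto simp: grid_def)
  have grid_ge: "r \<le> grid n (\<iota> n r)" and grid_le: "grid n (\<iota> n r) \<le> r + 1 / real (Suc n)" if "r \<in> {0..T}" for n r
  proof -
    have "r * real (Suc n) \<le> real (\<iota> n r)" "real (\<iota> n r) \<le> r * real (Suc n) + 1"
      using that by (auto simp: \<iota>_def intro!: real_nat_ceiling_ge)
    then have "r \<le> real (\<iota> n r) / real (Suc n)"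
      and "real (\<iota> n r) / real (Suc n) \<le> (r * real (Suc n) + 1) / real (Suc n)"
      by (simp add: pos_le_divide_eq del: of_nat_Suc, intro divide_right_mono) auto
    moreover have "(r * real (Suc n) + 1) / real (Suc n) = r + 1 / real (Suc n)"
      by (simp add: add_divide_distrib del: of_nat_Suc)
    ultimately have "r \<le> real (\<iota> n r) / real (Suc n)"
      "real (\<iota> n r) / real (Suc n) \<le> r + 1 / real (Suc n)" by simp_all
    then show "r \<le> grid n (\<iota> n r)" "grid n (\<iota> n r) \<le> r + 1 / real (Suc n)"
      using that by (auto simp: grid_def)
  qed
  \<comment> \<open>Measurability for a fixed grid time is known only for starting times up to it.
    The cut-off makes \<open>G n i\<close> Borel everywhere and is inactive at the index
    \<open>\<iota> n r\<close>.\<close>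
  define G where "G n i = (\<lambda>p. indicator {0..grid n i} (fst p) *\<^sub>R (LINT \<omega>|P (fst p) (snd p). Y (grid n i) \<omega>))" for n i
  have Gm: "G n i \<in> borel_measurable BTS" for n i
  proof -
    have "(\<lambda>(r, x). LINT \<omega>|P r x. Y (grid n i) \<omega>) \<in> borel_measurable (slab (grid n i))"
      unfolding Y_def
      by (rule expectation_measurable) (use grid[of n i] path_integral_measurable[OF assms] in auto)
    then have "borel_on d {0..grid n i} UNIV (\<lambda>r x. LINT \<omega>|P r x. Y (grid n i) \<omega>)"
      by (simp add: borel_on_UNIV)
    then have "(\<lambda>(r, x). indicator {0..grid n i} r *\<^sub>R (LINT \<omega>|P r x. Y (grid n i) \<omega>)) \<in> borel_measurable BTS"
      by (subst (asm) borel_on_slab_iff) (use grid[of n i] in auto)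
    then show ?thesis by (simp add: G_def case_prod_unfold)
  qed
  show ?thesis
  proof (rule borel_measurable_LIMSEQ_metric)
    show "(\<lambda>p. G n (\<iota> n (fst p)) p) \<in> borel_measurable BTS" for n
    proof (rule measurable_compose_countable[of "G n"])
      show "(\<lambda>p. \<iota> n (fst p)) \<in> BTS \<rightarrow>\<^sub>M count_space UNIV"
        unfolding \<iota>_def by measurable
    qed (rule Gm)
    fix p assume "p \<in> space BTS"
    then obtain r x where p: "p = (r, x)" and r: "r \<in> {0..T}" by auto
    have GE: "G n (\<iota> n r) p = (LINT \<omega>|P r x. Y (grid n (\<iota> n r)) \<omega>)" for n
      using grid_ge[OF r, of n] r by (simp add: G_def p)
    have lim: "(\<lambda>n. grid n (\<iota> n r)) \<longlonglongrightarrow> r"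
    proof (rule real_tendsto_sandwich[OF _ _ tendsto_const])
      show "(\<lambda>n. r + 1 / real (Suc n)) \<longlonglongrightarrow> r"
        using tendsto_add[OF tendsto_const LIMSEQ_inverse_real_of_nat, of r] by (simp add: inverse_eq_divide)
    qed (use grid_ge[OF r] grid_le[OF r] in auto)
    \<comment> \<open>The law \<open>P r x\<close> stays fixed and only the lower limit of the time
      integral moves, so convergence along each path and the common bound \<open>C\<close>
      suffice.\<close>
    have "(\<lambda>n. LINT \<omega>|P r x. Y (grid n (\<iota> n r)) \<omega>) \<longlonglongrightarrow> (LINT \<omega>|P r x. Y r \<omega>)"
    proof (rule integral_dominated_convergence[where w = "\<lambda>_. C"])
      interpret prob_space "P r x" using prob r by simp
      show "integrable (P r x) (\<lambda>_. C)" by simp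
      have "Y t \<in> borel_measurable (P r x)" if "t \<in> {0..T}" for t
        unfolding Y_def measurable_P[OF r] by (rule path_integral_measurable_M[OF assms]) (use that in auto)
      then show "Y r \<in> borel_measurable (P r x)" "\<And>n. Y (grid n (\<iota> n r)) \<in> borel_measurable (P r x)"
        using r grid by auto
      show "AE \<omega> in P r x. (\<lambda>n. Y (grid n (\<iota> n r)) \<omega>) \<longlonglongrightarrow> Y r \<omega>"
        unfolding Y_def
        by (rule AE_I2, rule set_integral_tendsto[OF path_integrable[OF assms] lim]) (simp add: space_P[OF r])
      show "AE \<omega> in P r x. norm (Y (grid n (\<iota> n r)) \<omega>) \<le> C" for n
        unfolding Y_def by (rule AE_I2) (use C in \<open>simp add: space_P[OF r]\<close>)
    qed
    then show "(\<lambda>n. G n (\<iota> n (fst p)) p) \<longlonglongrightarrow> (case p of (r, x) \<Rightarrow> future_integral \<phi> r x)"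
      using GE by (simp add: p future_integral_def Y_def)
  qed
qed

end

section \<open>The Markov property of the integral equation and Lipschitz estimates\<close>

context markov_time_integral
begin

definition terminal_expectation :: "('s \<Rightarrow> 'b::euclidean_space) \<Rightarrow> real \<Rightarrow> 's \<Rightarrow> 'b" where
  "terminal_expectation g r x = (LINT \<omega>|P r x. g (X T \<omega>))"

lemma terminal_measurable:
  assumes "g \<in> borel_measurable borel" "t \<in> {0..T}"
  shows "(\<lambda>\<omega>. g (X T \<omega>)) \<in> borel_measurable (future t)"
  by (rule measurable_compose[OF measurable_X_natural_sigma assms(1)]) (use assms in auto)

lemma terminal_integrable:
  fixes g :: "'s \<Rightarrow> 'b::euclidean_space"
  assumes "g \<in> borel_measurable borel" "\<And>x. norm (g x) \<le> G" "r \<in> {0..T}"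
  shows "integrable (P r x) (\<lambda>\<omega>. g (X T \<omega>))"
proof (rule bounded_integrable_P[OF assms(3)])
  show "(\<lambda>\<omega>. g (X T \<omega>)) \<in> borel_measurable M"
    by (rule measurable_compose[OF measurable_X assms(1)]) (use T_pos in auto)
qed (rule assms(2))

lemma terminal_expectation_measurable:
  assumes "g \<in> borel_measurable borel"
  shows "(\<lambda>(r, x). terminal_expectation g r x) \<in> borel_measurable BTS"
  unfolding terminal_expectation_def
  by (rule expectation_measurable[OF _ _ terminal_measurable[OF assms]]) (use T_pos in auto)

lemma norm_terminal_expectation_le:
  assumes "\<And>x. norm (g x) \<le> G" "r \<in> {0..T}"
  shows "norm (terminal_expectation g r x) \<le> G"
  unfolding terminal_expectation_def by (rule norm_expectation_le[OF assms(2,1)])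

text \<open>Both sides are expectations of the same functional of the future of \<open>t\<close>, since
  \<open>u t y\<close> is its expectation under \<open>P t y\<close>.\<close>

lemma markov_integral_equation:
  assumes g: "g \<in> borel_measurable borel" "\<And>x. norm (g x) \<le> G" and \<phi>: "dominated \<phi>"
    and rt: "0 \<le> r" "r \<le> t" "t \<le> T"
    and u: "\<And>s y. s \<in> {r..T} \<Longrightarrow> u s y = terminal_expectation g s y - future_integral \<phi> s y"
  shows "(LINT \<omega>|P r x. u t (X t \<omega>)) = u r x + (LINT \<omega>|P r x. (LINT s:{r..t}|mu. \<phi> s (X s \<omega>)))"
proof -
  define Z where "Z a \<omega> = g (X T \<omega>) - (LINT s:{a..T}|mu. \<phi> s (X s \<omega>))" for a \<omega>
  have r: "r \<in> {0..T}" and t: "t \<in> {0..T}" using rt by auto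
  have EZ: "(LINT \<omega>|P s y. Z a \<omega>) = terminal_expectation g s y - (LINT \<omega>|P s y. (LINT s:{a..T}|mu. \<phi> s (X s \<omega>)))"
    if "s \<in> {0..T}" "a \<in> {0..T}" for s a y
    unfolding Z_def terminal_expectation_def
    by (rule Bochner_Integration.integral_diff[OF terminal_integrable[OF g that(1)] path_integral_integrable[OF \<phi> that(2,1)]])
  have uZ: "u s y = (LINT \<omega>|P s y. Z s \<omega>)" if "s \<in> {r..T}" for s y
    using EZ[of s s y] u[OF that] that rt by (simp add: future_integral_def)
  obtain C where C: "\<And>I \<omega>. I \<in> sets borel \<Longrightarrow> \<omega> \<in> space M \<Longrightarrow> norm (LINT s:I|mu. \<phi> s (X s \<omega>)) \<le> C"
    by (rule path_integral_bounded[OF \<phi>]) blast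
  have "(LINT \<omega>|P r x. u t (X t \<omega>)) = (LINT \<omega>|P r x. (LINT \<omega>'|P t (X t \<omega>). Z t \<omega>'))"
    using uZ[of t] rt by simp
  also have "\<dots> = (LINT \<omega>|P r x. Z t \<omega>)"
  proof (rule expectation_markov[OF rt])
    show "Z t \<in> borel_measurable (future t)"
      unfolding Z_def
      by (rule borel_measurable_diff[OF terminal_measurable[OF g(1) t] path_integral_measurable[OF \<phi>]]) (use t in auto)
    show "norm (Z t \<omega>) \<le> G + C" if "\<omega> \<in> space M" for \<omega>
      unfolding Z_def
      using norm_triangle_ineq4[of "g (X T \<omega>)" "LINT s:{t..T}|mu. \<phi> s (X s \<omega>)"]
        g(2)[of "X T \<omega>"] C[OF Icc_borel that, of t T] by linarith
  qed
  also have "\<dots> = terminal_expectation g r x - (LINT \<omega>|P r x. (LINT s:{t..T}|mu. \<phi> s (X s \<omega>)))"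
    by (rule EZ[OF r t])
  also have "(LINT \<omega>|P r x. (LINT s:{t..T}|mu. \<phi> s (X s \<omega>))) =
      future_integral \<phi> r x - (LINT \<omega>|P r x. (LINT s:{r..t}|mu. \<phi> s (X s \<omega>)))"
  proof -
    have "future_integral \<phi> r x = (LINT \<omega>|P r x. (LINT s:{r..t}|mu. \<phi> s (X s \<omega>)) + (LINT s:{t..T}|mu. \<phi> s (X s \<omega>)))"
      unfolding future_integral_def
      by (rule Bochner_Integration.integral_cong[OF HOL.refl])
        (use set_integral_split[OF path_integrable[OF \<phi>] rt] space_P[OF r] in auto)
    also have "\<dots> = (LINT \<omega>|P r x. (LINT s:{r..t}|mu. \<phi> s (X s \<omega>))) + (LINT \<omega>|P r x. (LINT s:{t..T}|mu. \<phi> s (X s \<omega>)))"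
      by (rule Bochner_Integration.integral_add[OF path_integral_integrable[OF \<phi> r r] path_integral_integrable[OF \<phi> t r]])
    finally show ?thesis by simp
  qed
  also have "terminal_expectation g r x - (future_integral \<phi> r x - (LINT \<omega>|P r x. (LINT s:{r..t}|mu. \<phi> s (X s \<omega>)))) =
      u r x + (LINT \<omega>|P r x. (LINT s:{r..t}|mu. \<phi> s (X s \<omega>)))"
    using u[of r x] rt by simp
  finally show ?thesis .
qed

lemma future_integral_T: "future_integral \<phi> T x = 0"
  unfolding future_integral_def set_integral_singleton_zero by simp

text \<open>Under \<open>P T x\<close> the terminal state is almost surely only at
  \<open>d\<close>-distance zero from \<open>x\<close>; consistency of \<open>g\<close> closes this
  gap.\<close>

lemma terminal_expectation_T:
  assumes "g \<in> borel_measurable borel" "consistent_terminal T d g"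
  shows "terminal_expectation g T x = g x"
proof -
  have T: "T \<in> {0..T}" using T_pos by simp
  interpret prob_space "P T x" using prob T by simp
  have "terminal_expectation g T x = (LINT \<omega>|P T x. g x)"
    unfolding terminal_expectation_def
  proof (rule integral_cong_AE)
    show "(\<lambda>\<omega>. g (X T \<omega>)) \<in> borel_measurable (P T x)"
      by (rule measurable_compose[OF measurable_X_P[OF T T] assms(1)])
    show "AE \<omega> in P T x. g (X T \<omega>) = g x"
      using start[OF T] by eventually_elim (use T assms(2) in \<open>auto simp: consistent_terminal_def\<close>)
  qed simp
  then show ?thesis by (simp add: prob_space)
qed

end

section \<open>Growth and Lipschitz bounds with integrable coefficients\<close>

context atomless_time_measure
begin

lemma mu_dominatedE:
  assumes "mu_dominated T mu d a"
  obtains b where "integrable mu b" "\<And>s. s \<in> {0..T} \<Longrightarrow> 0 \<le> b s" "AE s in mu. \<forall>y. a s y \<le> b s"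
  using assms unfolding mu_dominated_def by blast

text \<open>Adding the two dominating functions gives one coefficient for both terms of the affine
  bound, so a single weight controls the growth.\<close>

lemma affine_mu_boundedE:
  assumes "affine_mu_bounded T mu d UNIV f"
  obtains h where "integrable mu h" "\<And>s. s \<in> {0..T} \<Longrightarrow> 0 \<le> h s"
    "AE s in mu. \<forall>y w. norm (f s y w) \<le> h s * (1 + norm w)"
proof -
  obtain a b where ab: "mu_dominated T mu d a" "mu_dominated T mu d b"
    "\<forall>t\<in>{0..T}. \<forall>x. \<forall>w\<in>UNIV. norm (f t x w) \<le> a t x + b t x * norm w"
    using assms unfolding affine_mu_bounded_def by blast
  obtain a' where a': "integrable mu a'" "\<And>s. s \<in> {0..T} \<Longrightarrow> 0 \<le> a' s" "AE s in mu. \<forall>y. a s y \<le> a' s"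
    using mu_dominatedE[OF ab(1)] by blast
  obtain b' where b': "integrable mu b'" "\<And>s. s \<in> {0..T} \<Longrightarrow> 0 \<le> b' s" "AE s in mu. \<forall>y. b s y \<le> b' s"
    using mu_dominatedE[OF ab(2)] by blast
  show ?thesis
  proof
    show "integrable mu (\<lambda>s. a' s + b' s)" using a' b' by simp
    show "0 \<le> a' s + b' s" if "s \<in> {0..T}" for s using a'(2)[OF that] b'(2)[OF that] by simp
    show "AE s in mu. \<forall>y w. norm (f s y w) \<le> (a' s + b' s) * (1 + norm w)"
      using a'(3) b'(3) AE_space
    proof eventually_elim
      case (elim s)
      have s: "s \<in> {0..T}" using elim(3) by (simp add: space_mu)
      have "norm (f s y w) \<le> (a' s + b' s) * (1 + norm w)" for y w
      proof -
        have "norm (f s y w) \<le> a s y + b s y * norm w" using ab(3) s by blast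
        also have "\<dots> \<le> a' s + b' s * norm w" using elim by (intro add_mono mult_right_mono) auto
        also have "\<dots> \<le> a' s + b' s * norm w + (b' s + a' s * norm w)"
          using a'(2)[OF s] b'(2)[OF s] by simp
        also have "\<dots> = (a' s + b' s) * (1 + norm w)" by (simp add: algebra_simps)
        finally show ?thesis .
      qed
      then show ?case by blast
    qed
  qed
qed

text \<open>Points of the ball closer than a Lebesgue number lie in a common Lipschitz
  neighbourhood; for the others the growth bound already gives a Lipschitz estimate.\<close>

lemma Lipschitz_on_ball:
  fixes f :: "real \<Rightarrow> 's \<Rightarrow> 'v::euclidean_space \<Rightarrow> 'v"
  assumes lip: "locally_Lipschitz_mu_continuous T mu d UNIV f"
    and h: "integrable mu h" "\<And>s. s \<in> {0..T} \<Longrightarrow> 0 \<le> h s"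
      "AE s in mu. \<forall>y w. norm (f s y w) \<le> h s * (1 + norm w)"
  obtains k where "integrable mu k" "\<And>s. s \<in> {0..T} \<Longrightarrow> 0 \<le> k s"
    "AE s in mu. \<forall>y w w'. norm w \<le> R \<longrightarrow> norm w' \<le> R \<longrightarrow> norm (f s y w - f s y w') \<le> k s * norm (w - w')"
proof -
  \<comment> \<open>Bundling the requirements lets one choice yield the neighbourhood together with
    its coefficient; the null set may still depend on \<open>w0\<close>.\<close>
  define Q where "Q w0 U b \<longleftrightarrow> open U \<and> w0 \<in> U \<and> integrable mu b \<and> (\<forall>s\<in>{0..T}. 0 \<le> b s) \<and>
      (AE s in mu. \<forall>y. \<forall>w\<in>U. \<forall>w'\<in>U. norm (f s y w - f s y w') \<le> b s * norm (w - w'))"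
    for w0 :: 'v and U b
  have "\<exists>U b. Q w0 U b" for w0
  proof -
    obtain W l where W: "nbhd_in (closure UNIV) w0 W" "mu_dominated T mu d l"
      "\<forall>t\<in>{0..T}. \<forall>x. \<forall>w\<in>W \<inter> UNIV. \<forall>w'\<in>W \<inter> UNIV. norm (f t x w - f t x w') \<le> l t x * norm (w - w')"
      using lip unfolding locally_Lipschitz_mu_continuous_def by blast
    obtain U where U: "open U" "w0 \<in> U" "U \<subseteq> W" using W(1) unfolding nbhd_in_def by auto
    obtain b where b: "integrable mu b" "\<And>s. s \<in> {0..T} \<Longrightarrow> 0 \<le> b s" "AE s in mu. \<forall>y. l s y \<le> b s"
      using mu_dominatedE[OF W(2)] by blast
    have "AE s in mu. \<forall>y. \<forall>w\<in>U. \<forall>w'\<in>U. norm (f s y w - f s y w') \<le> b s * norm (w - w')"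
      using b(3) AE_space
    proof eventually_elim
      case (elim s)
      have s: "s \<in> {0..T}" using elim(2) by (simp add: space_mu)
      have "norm (f s y w - f s y w') \<le> b s * norm (w - w')" if "w \<in> U" "w' \<in> U" for y w w'
      proof -
        have "norm (f s y w - f s y w') \<le> l s y * norm (w - w')" using W(3) s that U by blast
        also have "\<dots> \<le> b s * norm (w - w')" using elim by (intro mult_right_mono) auto
        finally show ?thesis .
      qed
      then show ?case by blast
    qed
    then show ?thesis using U b unfolding Q_def by blast
  qed
  then have "\<forall>w0. \<exists>U b. Q w0 U b" by blast
  then obtain U b where "\<forall>w0. Q w0 (U w0) (b w0)" unfolding choice_iff by (elim exE)
  then have U: "\<And>w0. open (U w0)" "\<And>w0. w0 \<in> U w0"
    and b: "\<And>w0. integrable mu (b w0)" "\<And>w0 s. s \<in> {0..T} \<Longrightarrow> 0 \<le> b w0 s"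
      "\<And>w0. AE s in mu. \<forall>y. \<forall>w\<in>U w0. \<forall>w'\<in>U w0. norm (f s y w - f s y w') \<le> b w0 s * norm (w - w')"
    unfolding Q_def by simp_all
  have cpt: "compact (cball (0::'v) R)" by simp
  obtain C where C: "finite C" "C \<subseteq> cball 0 R" "cball 0 R \<subseteq> (\<Union>c\<in>C. U c)"
    by (rule compactE_image[OF cpt, of "cball 0 R" U]) (use U in auto)
  obtain e where e: "0 < e" "\<And>w. w \<in> cball 0 R \<Longrightarrow> \<exists>G\<in>U ` C. ball w e \<subseteq> G"
    by (rule Heine_Borel_lemma[OF cpt, of "U ` C"]) (use C U in auto)
  \<comment> \<open>The sum serves pairs inside one neighbourhood of the cover. The second term
    serves pairs at distance at least \<open>e\<close>: both values are at most
    \<open>h s * (1 + \<bar>R\<bar>)\<close>, and dividing their sum by \<open>e\<close> produces a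
    slope.\<close>
  define k where "k s = (\<Sum>c\<in>C. b c s) + 2 * (1 + \<bar>R\<bar>) / e * h s" for s
  show ?thesis
  proof
    show "integrable mu k" unfolding k_def using h b by simp
    show "0 \<le> k s" if "s \<in> {0..T}" for s
      unfolding k_def using h(2)[OF that] b(2)[OF that] e by (intro add_nonneg_nonneg sum_nonneg) auto
    \<comment> \<open>Compactness matters here as well: finitely many neighbourhoods share one null
      set.\<close>
    have "AE s in mu. \<forall>c\<in>C. \<forall>y. \<forall>w\<in>U c. \<forall>w'\<in>U c. norm (f s y w - f s y w') \<le> b c s * norm (w - w')"
      by (rule AE_finite_allI[OF C(1)]) (rule b(3))
    then show "AE s in mu. \<forall>y w w'. norm w \<le> R \<longrightarrow> norm w' \<le> R \<longrightarrow>
        norm (f s y w - f s y w') \<le> k s * norm (w - w')"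
      using h(3) AE_space
    proof eventually_elim
      case (elim s)
      have s: "s \<in> {0..T}" using elim(3) by (simp add: space_mu)
      have hs: "0 \<le> h s" and bs: "\<And>c. 0 \<le> b c s" using h(2) b(2) s by auto
      have "norm (f s y w - f s y w') \<le> k s * norm (w - w')" if w: "norm w \<le> R" "norm w' \<le> R" for y w w'
      proof (cases "norm (w - w') < e")
        case True
        obtain c where c: "c \<in> C" "ball w e \<subseteq> U c" using e(2)[of w] w by auto
        have "w \<in> U c" "w' \<in> U c" using c True e(1) by (auto simp: dist_norm)
        then have "norm (f s y w - f s y w') \<le> b c s * norm (w - w')" using elim(1) c by blast
        also have "\<dots> \<le> k s * norm (w - w')"
        proof (rule mult_right_mono)
          have "b c s \<le> (\<Sum>c\<in>C. b c s)" by (rule member_le_sum) (use c C bs in auto)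
          then show "b c s \<le> k s" unfolding k_def using hs e by (intro add_increasing2) auto
        qed simp
        finally show ?thesis .
      next
        case False
        have fb: "norm (f s y v) \<le> h s * (1 + \<bar>R\<bar>)" if "norm v \<le> R" for v
        proof -
          have "norm (f s y v) \<le> h s * (1 + norm v)" using elim(2) by blast
          also have "\<dots> \<le> h s * (1 + \<bar>R\<bar>)" using that hs by (intro mult_left_mono) auto
          finally show ?thesis .
        qed
        have "norm (f s y w - f s y w') \<le> norm (f s y w) + norm (f s y w')" by (rule norm_triangle_ineq4)
        also have "\<dots> \<le> 2 * (1 + \<bar>R\<bar>) * h s" using fb[OF w(1)] fb[OF w(2)] by (simp add: algebra_simps)
        also have "\<dots> = 2 * (1 + \<bar>R\<bar>) / e * h s * e" using e by simp
        also have "\<dots> \<le> 2 * (1 + \<bar>R\<bar>) / e * h s * norm (w - w')"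
          using False hs e by (intro mult_left_mono) auto
        also have "\<dots> \<le> k s * norm (w - w')"
          unfolding k_def using bs by (intro mult_right_mono) (auto intro: sum_nonneg)
        finally show ?thesis .
      qed
      then show ?case by blast
    qed
  qed
qed

end

section \<open>Picard iteration\<close>

lemma bounded_onI:
  fixes u :: "real \<Rightarrow> 's \<Rightarrow> 'b::real_normed_vector"
  assumes "\<And>r x. r \<in> I \<Longrightarrow> norm (u r x) \<le> C"
  shows "bounded_on I u"
  unfolding bounded_on_def bounded_iff using assms by auto

lemma bounded_onE:
  fixes u :: "real \<Rightarrow> 's \<Rightarrow> 'b::real_normed_vector"
  assumes "bounded_on I u"
  obtains C where "\<And>r x. r \<in> I \<Longrightarrow> norm (u r x) \<le> C"
  using assms unfolding bounded_on_def bounded_iff by auto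

locale markov_integral_problem =
  markov_time_integral T d M X F P mu
  for T :: real and d :: "real \<times> 's::topological_space \<Rightarrow> real \<times> 's \<Rightarrow> real"
    and M :: "'w measure" and X F and P :: "real \<Rightarrow> 's \<Rightarrow> 'w measure" and mu :: "real measure" +
  fixes f :: "real \<Rightarrow> 's \<Rightarrow> 'v::euclidean_space \<Rightarrow> 'v" and g :: "'s \<Rightarrow> 'v" and G :: real and h :: "real \<Rightarrow> real"
  assumes g_borel: "g \<in> borel_measurable borel" and g_bound: "\<And>x. norm (g x) \<le> G"
    and g_consistent: "consistent_terminal T d g"
    and f_borel: "jointly_borel T d UNIV f"
    and f_Lipschitz: "locally_Lipschitz_mu_continuous T mu d UNIV f"
    and h_integrable: "integrable mu h" and h_nonneg: "\<And>s. s \<in> {0..T} \<Longrightarrow> 0 \<le> h s"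
    and f_growth: "AE s in mu. \<forall>y w. norm (f s y w) \<le> h s * (1 + norm w)"
begin

definition superposition :: "(real \<Rightarrow> 's \<Rightarrow> 'v) \<Rightarrow> real \<Rightarrow> 's \<Rightarrow> 'v" where
  "superposition u = (\<lambda>s y. f s y (u s y))"

lemma superposition_dominated:
  assumes u: "(\<lambda>(s, y). u s y) \<in> borel_measurable BTS" and R: "\<And>s y. s \<in> {0..T} \<Longrightarrow> norm (u s y) \<le> R"
  shows "dominated (superposition u)"
proof (rule dominatedI)
  have "(\<lambda>p. (p, case p of (s, y) \<Rightarrow> u s y)) \<in> BTS \<rightarrow>\<^sub>M BTS \<Otimes>\<^sub>M restrict_space borel UNIV"
    by (rule measurable_Pair[OF measurable_ident_sets[OF HOL.refl] measurable_restrict_space2[OF _ u]]) simp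
  from measurable_compose[OF this f_borel[unfolded jointly_borel_def]]
  show "(\<lambda>(s, y). superposition u s y) \<in> borel_measurable BTS"
    by (simp add: superposition_def case_prod_unfold)
  show "integrable mu (\<lambda>s. h s * (1 + R))" using h_integrable by simp
  show "AE s in mu. \<forall>y. norm (superposition u s y) \<le> h s * (1 + R)"
    using f_growth AE_space
  proof eventually_elim
    case (elim s)
    have s: "s \<in> {0..T}" using elim(2) by (simp add: space_mu)
    have "norm (f s y (u s y)) \<le> h s * (1 + R)" for y
    proof -
      have "norm (f s y (u s y)) \<le> h s * (1 + norm (u s y))" using elim(1) by blast
      also have "\<dots> \<le> h s * (1 + R)" using R[OF s] h_nonneg[OF s] by (intro mult_left_mono) auto
      finally show ?thesis .
    qed
    then show ?case by (simp add: superposition_def)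
  qed
qed

abbreviation iterate :: "nat \<Rightarrow> real \<Rightarrow> 's \<Rightarrow> 'v" where "iterate \<equiv> picard T mu X P f g"

lemma iterate_0: "iterate 0 r x = terminal_expectation g r x"
  by (simp add: terminal_expectation_def)

lemma iterate_Suc:
  "iterate (Suc n) r x = terminal_expectation g r x - future_integral (superposition (iterate n)) r x"
  by (simp add: terminal_expectation_def future_integral_def superposition_def)

text \<open>\<open>2 * G + 1\<close> solves \<open>A = G + (A + 1) / 2\<close>: the terminal term
  contributes \<open>G\<close>, and iterates of weighted size \<open>A\<close> contribute
  \<open>(A + 1) / 2\<close> through growth and contraction. The factor \<open>weight h 0\<close> is
  the largest weight and turns the weighted bound into a uniform one.\<close>

definition radius :: real where "radius = (2 * G + 1) * weight h 0"

lemma G_nonneg: "0 \<le> G"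
  using g_bound norm_ge_zero order_trans by blast

lemma weighted_le_radius: "s \<in> {0..T} \<Longrightarrow> (2 * G + 1) * weight h s \<le> radius"
  unfolding radius_def using weight_le[OF h_integrable h_nonneg] G_nonneg by (intro mult_left_mono) auto

lemma radius_nonneg: "0 \<le> radius"
  unfolding radius_def using weight_ge_1[OF h_integrable h_nonneg, of 0] G_nonneg by simp

text \<open>Both parts share one induction, since measurability of the next iterate rests on a
  dominated integrand and hence on the bound. The bound must stay in weighted form to reproduce
  itself.\<close>

lemma iterate_properties:
  "(\<lambda>(r, x). iterate n r x) \<in> borel_measurable BTS \<and>
   (\<forall>r\<in>{0..T}. \<forall>x. norm (iterate n r x) \<le> (2 * G + 1) * weight h r)"
proof (induct n)
  case 0
  have "norm (iterate 0 r x) \<le> (2 * G + 1) * weight h r" if "r \<in> {0..T}" for r x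
  proof -
    have "norm (iterate 0 r x) \<le> G" unfolding iterate_0 by (rule norm_terminal_expectation_le[OF g_bound that])
    also have "G * 1 \<le> (2 * G + 1) * weight h r"
      using weight_ge_1[OF h_integrable h_nonneg, of r] G_nonneg by (intro mult_mono) auto
    finally show ?thesis by simp
  qed
  moreover have "(\<lambda>(r, x). iterate 0 r x) \<in> borel_measurable BTS"
    unfolding iterate_0 by (rule terminal_expectation_measurable[OF g_borel])
  ultimately show ?case by blast
next
  case (Suc n)
  have dom: "dominated (superposition (iterate n))"
    by (rule superposition_dominated[where R = radius]) (use Suc weighted_le_radius order_trans in blast)+
  have "(\<lambda>p. (case p of (r, x) \<Rightarrow> terminal_expectation g r x)
      - (case p of (r, x) \<Rightarrow> future_integral (superposition (iterate n)) r x)) \<in> borel_measurable BTS"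
    by (rule borel_measurable_diff[OF terminal_expectation_measurable[OF g_borel] future_integral_measurable[OF dom]])
  then have "(\<lambda>(r, x). iterate (Suc n) r x) \<in> borel_measurable BTS"
    unfolding iterate_Suc by (simp add: case_prod_unfold)
  moreover have "norm (iterate (Suc n) r x) \<le> (2 * G + 1) * weight h r" if r: "r \<in> {0..T}" for r x
  proof -
    have "norm (future_integral (superposition (iterate n)) r x) \<le> (2 * G + 2) / 2 * weight h r"
    proof (rule norm_future_integral_le[OF dom r h_integrable h_nonneg])
      show "AE s in mu. r \<le> s \<longrightarrow> (\<forall>y. norm (superposition (iterate n) s y) \<le> (2 * G + 2) * (h s * weight h s))"
        using f_growth AE_space
      proof eventually_elim
        case (elim s)
        have s: "s \<in> {0..T}" using elim(2) by (simp add: space_mu)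
        have "norm (f s y (iterate n s y)) \<le> (2 * G + 2) * (h s * weight h s)" for y
        proof -
          have "norm (f s y (iterate n s y)) \<le> h s * (1 + norm (iterate n s y))" using elim(1) by blast
          \<comment> \<open>A weight of at least 1 absorbs the constant term of the growth bound,
            whence the constant \<open>2 * G + 2\<close>.\<close>
          also have "\<dots> \<le> h s * (weight h s + (2 * G + 1) * weight h s)"
            using Suc s h_nonneg[OF s] weight_ge_1[OF h_integrable h_nonneg, of s]
            by (intro mult_left_mono add_mono) auto
          also have "\<dots> = (2 * G + 2) * (h s * weight h s)" by (simp add: algebra_simps)
          finally show ?thesis .
        qed
        then show ?case by (simp add: superposition_def)
      qed
    qed (use G_nonneg in auto)
    moreover have "norm (terminal_expectation g r x) \<le> G * weight h r"
    proof -
      have "norm (terminal_expectation g r x) \<le> G * 1"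
        using norm_terminal_expectation_le[OF g_bound r] by simp
      also have "\<dots> \<le> G * weight h r"
        using weight_ge_1[OF h_integrable h_nonneg, of r] G_nonneg by (intro mult_left_mono) auto
      finally show ?thesis .
    qed
    moreover have "norm (iterate (Suc n) r x) \<le>
        norm (terminal_expectation g r x) + norm (future_integral (superposition (iterate n)) r x)"
      unfolding iterate_Suc by (rule norm_triangle_ineq4)
    ultimately have "norm (iterate (Suc n) r x) \<le> G * weight h r + (2 * G + 2) / 2 * weight h r" by linarith
    also have "\<dots> = (2 * G + 1) * weight h r" by (simp add: field_simps)
    finally show ?thesis .
  qed
  ultimately show ?case by blast
qed

lemma iterate_measurable: "(\<lambda>(r, x). iterate n r x) \<in> borel_measurable BTS"
  using iterate_properties by blast

lemma iterate_bound: "r \<in> {0..T} \<Longrightarrow> norm (iterate n r x) \<le> radius"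
  using iterate_properties[of n] weighted_le_radius[of r] order_trans by blast

lemma iterate_dominated: "dominated (superposition (iterate n))"
  by (rule superposition_dominated[OF iterate_measurable iterate_bound])

text \<open>The difference is assumed small only on \<open>{r..T}\<close>, the times seen by the
  integral from \<open>r\<close>; this lets the same estimate serve for uniqueness on
  subintervals.\<close>

lemma superposition_contraction:
  assumes k: "integrable mu k" "\<And>s. s \<in> {0..T} \<Longrightarrow> 0 \<le> k s"
    "AE s in mu. \<forall>y w w'. norm w \<le> R \<longrightarrow> norm w' \<le> R \<longrightarrow> norm (f s y w - f s y w') \<le> k s * norm (w - w')"
    and dom: "dominated (superposition u)" "dominated (superposition v)"
    and bound: "\<And>s y. s \<in> {0..T} \<Longrightarrow> norm (u s y) \<le> R" "\<And>s y. s \<in> {0..T} \<Longrightarrow> norm (v s y) \<le> R"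
    and diff: "\<And>s y. s \<in> {r..T} \<Longrightarrow> norm (u s y - v s y) \<le> K * weight k s"
    and r: "r \<in> {0..T}" and K: "0 \<le> K"
  shows "norm (future_integral (superposition u) r x - future_integral (superposition v) r x) \<le> K / 2 * weight k r"
  unfolding future_integral_diff[OF dom r]
proof (rule norm_future_integral_le[OF dominated_diff[OF dom] r k(1,2) K])
  show "AE s in mu. r \<le> s \<longrightarrow> (\<forall>y. norm (superposition u s y - superposition v s y) \<le> K * (k s * weight k s))"
    using k(3) AE_space
  proof eventually_elim
    case (elim s)
    have s: "s \<in> {0..T}" using elim(2) by (simp add: space_mu)
    have "norm (f s y (u s y) - f s y (v s y)) \<le> K * (k s * weight k s)" if "r \<le> s" for y
    proof -
      have "norm (f s y (u s y) - f s y (v s y)) \<le> k s * norm (u s y - v s y)"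
        using elim(1) bound s by blast
      also have "\<dots> \<le> k s * (K * weight k s)"
        using diff[of s y] k(2)[OF s] s that by (intro mult_left_mono) auto
      finally show ?thesis by (simp add: algebra_simps)
    qed
    then show ?case by (simp add: superposition_def)
  qed
qed

lemma iterates_converge:
  obtains u where "(\<lambda>(r, x). u r x) \<in> borel_measurable BTS"
    "\<And>r x. r \<in> {0..T} \<Longrightarrow> norm (u r x) \<le> radius"
    "uniform_limit ({0..T} \<times> UNIV) (\<lambda>n (r, x). iterate n r x) (\<lambda>(r, x). u r x) sequentially"
    "\<And>r x. r \<in> {0..T} \<Longrightarrow> u r x = terminal_expectation g r x - future_integral (superposition u) r x"
proof -
  obtain k where k: "integrable mu k" "\<And>s. s \<in> {0..T} \<Longrightarrow> 0 \<le> k s"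
    "AE s in mu. \<forall>y w w'. norm w \<le> radius \<longrightarrow> norm w' \<le> radius \<longrightarrow> norm (f s y w - f s y w') \<le> k s * norm (w - w')"
    by (rule Lipschitz_on_ball[where R = radius, OF f_Lipschitz h_integrable h_nonneg f_growth], assumption, rule that)
  note W1 = weight_ge_1[OF k(1,2)]
  \<comment> \<open>The triangle inequality bounds the first difference by the diameter of the ball;
    each further step halves the weighted distance.\<close>
  have step: "\<forall>r\<in>{0..T}. \<forall>x. norm (iterate (Suc n) r x - iterate n r x) \<le> 2 * radius / 2 ^ n * weight k r" for n
  proof (induct n)
    case 0
    have "norm (iterate (Suc 0) r x - iterate 0 r x) \<le> 2 * radius / 2 ^ 0 * weight k r" if r: "r \<in> {0..T}" for r x
    proof -
      have "norm (iterate (Suc 0) r x - iterate 0 r x) \<le> norm (iterate (Suc 0) r x) + norm (iterate 0 r x)"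
        by (rule norm_triangle_ineq4)
      also have "\<dots> \<le> 2 * radius * 1" using iterate_bound[OF r, of "Suc 0" x] iterate_bound[OF r, of 0 x] by linarith
      also have "\<dots> \<le> 2 * radius * weight k r"
        using W1[of r] radius_nonneg by (intro mult_left_mono) auto
      finally show ?thesis by simp
    qed
    then show ?case by blast
  next
    case (Suc n)
    have "norm (iterate (Suc (Suc n)) r x - iterate (Suc n) r x) \<le> 2 * radius / 2 ^ Suc n * weight k r"
      if r: "r \<in> {0..T}" for r x
    proof -
      have "iterate (Suc (Suc n)) r x - iterate (Suc n) r x =
          future_integral (superposition (iterate n)) r x - future_integral (superposition (iterate (Suc n))) r x"
        unfolding iterate_Suc[of "Suc n"] iterate_Suc[of n r x] by simp
      moreover have "norm (future_integral (superposition (iterate (Suc n))) r x - future_integral (superposition (iterate n)) r x)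
          \<le> 2 * radius / 2 ^ n / 2 * weight k r"
        by (rule superposition_contraction[OF k iterate_dominated iterate_dominated iterate_bound iterate_bound])
          (use Suc r radius_nonneg in auto)
      ultimately show ?thesis by (simp add: norm_minus_commute mult.commute)
    qed
    then show ?case by blast
  qed
  \<comment> \<open>Telescoping makes the iterates partial sums of these differences. As the weight
    never exceeds \<open>weight k 0\<close>, the M-test gives plain uniform convergence.\<close>
  define D where "D n p = (case p of (r, x) \<Rightarrow> iterate (Suc n) r x - iterate n r x)" for n p
  have D: "norm (D n p) \<le> 2 * radius * weight k 0 * (1 / 2) ^ n" if pT: "p \<in> {0..T} \<times> UNIV" for n p
  proof -
    obtain r x where p: "p = (r, x)" "r \<in> {0..T}" using pT by auto
    have "norm (D n p) \<le> 2 * radius / 2 ^ n * weight k r" using step p by (simp add: D_def)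
    also have "\<dots> \<le> 2 * radius / 2 ^ n * weight k 0"
      using weight_le[OF k(1,2) p(2)] radius_nonneg by (intro mult_left_mono) auto
    finally show ?thesis by (simp add: power_one_over field_simps)
  qed
  define u where "u r x = iterate 0 r x + (\<Sum>n. D n (r, x))" for r x
  have summ: "summable (\<lambda>n. 2 * radius * weight k 0 * (1 / 2 :: real) ^ n)"
    by (intro summable_mult summable_geometric) simp
  have "uniform_limit ({0..T} \<times> UNIV) (\<lambda>n p. \<Sum>i<n. D i p) (\<lambda>p. \<Sum>i. D i p) sequentially"
    by (rule Weierstrass_m_test[OF _ summ]) (rule D)
  then have "uniform_limit ({0..T} \<times> UNIV) (\<lambda>n p. (case p of (r, x) \<Rightarrow> iterate 0 r x) + (\<Sum>i<n. D i p))
      (\<lambda>p. (case p of (r, x) \<Rightarrow> iterate 0 r x) + (\<Sum>i. D i p)) sequentially"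
    by (intro uniform_limit_add uniform_limit_const)
  moreover have "(case p of (r, x) \<Rightarrow> iterate 0 r x) + (\<Sum>i<n. D i p) = (case p of (r, x) \<Rightarrow> iterate n r x)" for n p
  proof (cases p)
    case (Pair r x)
    then show ?thesis
      using sum_lessThan_telescope[of "\<lambda>i. iterate i r x" n] by (simp add: D_def del: picard.simps)
  qed
  ultimately have ul: "uniform_limit ({0..T} \<times> UNIV) (\<lambda>n (r, x). iterate n r x) (\<lambda>(r, x). u r x) sequentially"
    by (simp add: u_def case_prod_unfold del: picard.simps)
  have lim: "(\<lambda>n. iterate n r x) \<longlonglongrightarrow> u r x" if "r \<in> {0..T}" for r x
    using tendsto_uniform_limitI[OF ul, of "(r, x)"] that by simp
  have um: "(\<lambda>(r, x). u r x) \<in> borel_measurable BTS"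
    by (rule borel_measurable_LIMSEQ_metric[where f = "\<lambda>n (r, x). iterate n r x", OF iterate_measurable])
      (use lim in auto)
  have ub: "norm (u r x) \<le> radius" if "r \<in> {0..T}" for r x
    by (rule LIMSEQ_le_const2[OF tendsto_norm[OF lim[OF that]]]) (use iterate_bound[OF that] in auto)
  have fixed: "u r x = terminal_expectation g r x - future_integral (superposition u) r x" if r: "r \<in> {0..T}" for r x
  proof -
    have "(\<lambda>n. future_integral (superposition (iterate n)) r x) \<longlonglongrightarrow> future_integral (superposition u) r x"
    proof (rule metric_LIMSEQ_I)
      fix e :: real assume e: "0 < e"
      have w: "0 < weight k r" using W1[of r] by linarith
      \<comment> \<open>Chosen so that the contraction estimate with \<open>K = \<delta>\<close>
        yields \<open>e / 2\<close>.\<close>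
      define \<delta> where "\<delta> = e / weight k r"
      have \<delta>: "0 < \<delta>" using e w by (simp add: \<delta>_def)
      obtain N where N: "\<And>n s y. n \<ge> N \<Longrightarrow> s \<in> {0..T} \<Longrightarrow> dist (iterate n s y) (u s y) < \<delta>"
        using uniform_limitD[OF ul \<delta>] unfolding eventually_sequentially by fastforce
      have "dist (future_integral (superposition (iterate n)) r x) (future_integral (superposition u) r x) < e" if "n \<ge> N" for n
      proof -
        have d: "norm (iterate n s y - u s y) \<le> \<delta> * weight k s" if "s \<in> {r..T}" for s y
        proof -
          have "norm (iterate n s y - u s y) \<le> \<delta> * 1" using N[OF \<open>n \<ge> N\<close>, of s y] that r by (simp add: dist_norm)
          also have "\<dots> \<le> \<delta> * weight k s" using W1[of s] \<delta> by (intro mult_left_mono) auto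
          finally show ?thesis .
        qed
        have "norm (future_integral (superposition (iterate n)) r x - future_integral (superposition u) r x) \<le> \<delta> / 2 * weight k r"
          by (rule superposition_contraction[OF k iterate_dominated superposition_dominated[OF um ub] iterate_bound ub d r])
            (use \<delta> in auto)
        also have "\<dots> = e / 2" using w by (simp add: \<delta>_def)
        also have "\<dots> < e" using e by simp
        finally show ?thesis by (simp add: dist_norm)
      qed
      then show "\<exists>N. \<forall>n\<ge>N. dist (future_integral (superposition (iterate n)) r x) (future_integral (superposition u) r x) < e" by blast
    qed
    then have "(\<lambda>n. iterate (Suc n) r x) \<longlonglongrightarrow> terminal_expectation g r x - future_integral (superposition u) r x"
      unfolding iterate_Suc by (intro tendsto_diff tendsto_const)
    moreover have "(\<lambda>n. iterate (Suc n) r x) \<longlonglongrightarrow> u r x" using lim[OF r] by (rule LIMSEQ_Suc)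
    ultimately show ?thesis using LIMSEQ_unique by blast
  qed
  show ?thesis by (rule that[OF um ub ul fixed])
qed

text \<open>The fixed point equation relates \<open>r\<close> only to \<open>T\<close>; the Markov
  property supplies the intermediate times \<open>t\<close>. Consistency comes for free from Borel
  measurability, and domination gives integrability along every path, as \<open>solution\<close>
  demands.\<close>

lemma fixed_point_imp_solution:
  assumes um: "(\<lambda>(r, x). u r x) \<in> borel_measurable BTS"
    and ub: "\<And>r x. r \<in> {0..T} \<Longrightarrow> norm (u r x) \<le> R"
    and fixed: "\<And>r x. r \<in> {0..T} \<Longrightarrow> u r x = terminal_expectation g r x - future_integral (superposition u) r x"
  shows "solution T mu d M X P UNIV f g {0..T} u"
  unfolding solution_def
proof (intro conjI ballI allI impI)
  have dom: "dominated (superposition u)" by (rule superposition_dominated[OF um ub])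
  show "admissible_interval T {0..T}" unfolding admissible_interval_def using T_pos by (intro exI[of _ 0]) auto
  show bo: "borel_on d {0..T} UNIV u" unfolding borel_on_UNIV by (rule um)
  show "consistent_on d {0..T} u" by (rule borel_on_imp_consistent_on[OF order_refl bo])
  show "u T x = g x" for x
    using fixed[of T x] T_pos terminal_expectation_T[OF g_borel g_consistent] future_integral_T by simp
  fix r t x assume r: "r \<in> {0..T}" and t: "t \<in> {0..T}" and rt: "r \<le> t"
  have "u t \<in> borel_measurable borel"
    using measurable_compose[OF measurable_Pair_state[OF t] um] by simp
  from measurable_compose[OF measurable_X[OF t] this]
  have "integrable (P r x) (\<lambda>\<omega>. u t (X t \<omega>))"
    by (rule bounded_integrable_P[OF r]) (rule ub[OF t])
  then show "integrable (P r x) (\<lambda>\<omega>. norm (u t (X t \<omega>)))" by (rule integrable_norm)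
  show "set_integrable mu {r..t} (\<lambda>s. f s (X s \<omega>) (u s (X s \<omega>)))" if "\<omega> \<in> space M" for \<omega>
    using path_set_integrable[OF dom that Icc_borel] by (simp add: superposition_def)
  show "integrable (P r x) (\<lambda>\<omega>. LINT s:{r..t}|mu. norm (f s (X s \<omega>) (u s (X s \<omega>))))"
    using path_integral_integrable[OF dominated_norm[OF dom] r r] by (simp add: superposition_def)
  have "(LINT \<omega>|P r x. u t (X t \<omega>)) = u r x + (LINT \<omega>|P r x. (LINT s:{r..t}|mu. superposition u s (X s \<omega>)))"
    by (rule markov_integral_equation[OF g_borel g_bound dom]) (use fixed r t rt in auto)
  then show "(LINT \<omega>|P r x. u t (X t \<omega>)) = u r x + (LINT \<omega>|P r x. (LINT s:{r..t}|mu. f s (X s \<omega>) (u s (X s \<omega>))))"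
    by (simp add: superposition_def)
qed

section \<open>Uniqueness on subintervals and the maximal interval\<close>

lemma admissible_interval_props:
  assumes "admissible_interval T J"
  shows "J \<subseteq> {0..T}" "J \<in> sets borel" "T \<in> J" "r \<in> J \<Longrightarrow> {r..T} \<subseteq> J"
  using assms unfolding admissible_interval_def by auto

lemma solution_interval:
  assumes "solution T mu d M X P UNIV f g J v"
  shows "J \<subseteq> {0..T}"
  by (rule admissible_interval_props(1)[OF conjunct1[OF assms[unfolded solution_def]]])

lemma admissible_solution_imp_solution:
  assumes "admissible_solution T mu d M X P UNIV f g J v"
  shows "solution T mu d M X P UNIV f g J v"
  by (rule conjunct1[OF assms[unfolded admissible_solution_def]])

text \<open>Taking \<open>t = T\<close> in the integral equation gives the fixed point form.
  \<open>v\<close> is uncontrolled outside \<open>J\<close> and may be unbounded near its left end,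
  so it is replaced by zero before \<open>r0\<close>; integrals over \<open>{r..T}\<close> with
  \<open>r \<ge> r0\<close> do not notice.\<close>

lemma solution_imp_fixed_point:
  assumes sol: "solution T mu d M X P UNIV f g J v" and r0: "r0 \<in> J"
    and bound: "\<And>r x. r \<in> {r0..T} \<Longrightarrow> norm (v r x) \<le> R"
  defines "v' \<equiv> \<lambda>s y. indicator {r0..T} s *\<^sub>R v s y"
  shows "(\<lambda>(s, y). v' s y) \<in> borel_measurable BTS"
    and "\<And>r x. r \<in> {r0..T} \<Longrightarrow> v' r x = terminal_expectation g r x - future_integral (superposition v') r x"
proof -
  have J: "admissible_interval T J" and bo: "borel_on d J UNIV v" and vT: "\<And>x. v T x = g x"
    and eq: "\<And>r t x. r \<in> J \<Longrightarrow> t \<in> J \<Longrightarrow> r \<le> t \<Longrightarrow>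
      (LINT \<omega>|P r x. v t (X t \<omega>)) = v r x + (LINT \<omega>|P r x. (LINT s:{r..t}|mu. f s (X s \<omega>) (v s (X s \<omega>))))"
    using sol unfolding solution_def by blast+
  note J' = admissible_interval_props[OF J]
  have r0T: "{r0..T} \<subseteq> J" by (rule J'(4)[OF r0])
  have "(\<lambda>(s, y). indicator J s *\<^sub>R v s y) \<in> borel_measurable BTS"
    using bo borel_on_slab_iff[OF J'(1,2)] by blast
  moreover have "(\<lambda>p. indicator {r0..T} (fst p) :: real) \<in> borel_measurable BTS"
    by (rule measurable_compose[OF fst_measurable]) simp
  ultimately have "(\<lambda>p. indicator {r0..T} (fst p) *\<^sub>R (case p of (s, y) \<Rightarrow> indicator J s *\<^sub>R v s y)) \<in> borel_measurable BTS"
    by (intro borel_measurable_scaleR)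
  also have "(\<lambda>p. indicator {r0..T} (fst p) *\<^sub>R (case p of (s, y) \<Rightarrow> indicator J s *\<^sub>R v s y)) = (\<lambda>(s, y). v' s y)"
    using r0T by (auto simp: v'_def indicator_def fun_eq_iff)
  finally show "(\<lambda>(s, y). v' s y) \<in> borel_measurable BTS" .
  fix r x assume r: "r \<in> {r0..T}"
  have "r \<in> J" using r r0T by blast
  from eq[OF this J'(3)] r
  have "terminal_expectation g r x = v r x + (LINT \<omega>|P r x. (LINT s:{r..T}|mu. f s (X s \<omega>) (v s (X s \<omega>))))"
    by (simp add: terminal_expectation_def vT)
  also have "(\<lambda>\<omega>. LINT s:{r..T}|mu. f s (X s \<omega>) (v s (X s \<omega>))) = (\<lambda>\<omega>. LINT s:{r..T}|mu. superposition v' s (X s \<omega>))"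
    unfolding set_lebesgue_integral_def superposition_def v'_def
    by (intro ext Bochner_Integration.integral_cong HOL.refl) (use r in \<open>auto simp: indicator_def\<close>)
  finally have "terminal_expectation g r x = v r x + future_integral (superposition v') r x"
    unfolding future_integral_def .
  then show "v' r x = terminal_expectation g r x - future_integral (superposition v') r x"
    using r by (simp add: v'_def)
qed

text \<open>On \<open>{r0..T}\<close> both functions satisfy the fixed point equation inside one
  ball, so any weighted bound on their distance can be halved; starting from \<open>2 * R\<close>,
  the distance is driven to zero.\<close>

lemma bounded_solution_unique:
  assumes um: "(\<lambda>(r, x). u r x) \<in> borel_measurable BTS"
    and ub: "\<And>r x. r \<in> {0..T} \<Longrightarrow> norm (u r x) \<le> C"
    and fixed: "\<And>r x. r \<in> {0..T} \<Longrightarrow> u r x = terminal_expectation g r x - future_integral (superposition u) r x"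
    and sol: "solution T mu d M X P UNIV f g J v" and r0: "r0 \<in> J"
    and vb: "\<And>r x. r \<in> {r0..T} \<Longrightarrow> norm (v r x) \<le> C'"
    and r: "r \<in> {r0..T}"
  shows "v r x = u r x"
proof -
  define v' where "v' = (\<lambda>s y. indicator {r0..T} s *\<^sub>R v s y)"
  define R where "R = max \<bar>C\<bar> \<bar>C'\<bar>"
  have v'm: "(\<lambda>(s, y). v' s y) \<in> borel_measurable BTS"
    and v'fixed: "\<And>r x. r \<in> {r0..T} \<Longrightarrow> v' r x = terminal_expectation g r x - future_integral (superposition v') r x"
    using solution_imp_fixed_point[OF sol r0 vb] unfolding v'_def by blast+
  have v'R: "norm (v' s y) \<le> R" if "s \<in> {0..T}" for s y
    using vb[of s y] by (auto simp: v'_def R_def indicator_def)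
  have uR: "norm (u s y) \<le> R" if "s \<in> {0..T}" for s y
    using ub[OF that, of y] by (auto simp: R_def)
  have R0: "0 \<le> R" by (simp add: R_def)
  have r0T: "{r0..T} \<subseteq> {0..T}"
    using solution_interval[OF sol] r0 by auto
  obtain k where k: "integrable mu k" "\<And>s. s \<in> {0..T} \<Longrightarrow> 0 \<le> k s"
    "AE s in mu. \<forall>y w w'. norm w \<le> R \<longrightarrow> norm w' \<le> R \<longrightarrow> norm (f s y w - f s y w') \<le> k s * norm (w - w')"
    by (rule Lipschitz_on_ball[where R = R, OF f_Lipschitz h_integrable h_nonneg f_growth], assumption, rule that)
  have step: "\<forall>r\<in>{r0..T}. \<forall>x. norm (v' r x - u r x) \<le> 2 * R / 2 ^ n * weight k r" for n
  proof (induct n)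
    case 0
    have "norm (v' r x - u r x) \<le> 2 * R / 2 ^ 0 * weight k r" if "r \<in> {r0..T}" for r x
    proof -
      have "r \<in> {0..T}" using that r0T by blast
      then have "norm (v' r x - u r x) \<le> 2 * R * 1"
        using norm_triangle_ineq4[of "v' r x" "u r x"] v'R[of r x] uR[of r x] by linarith
      also have "\<dots> \<le> 2 * R * weight k r"
        using weight_ge_1[OF k(1,2), of r] R0 by (intro mult_left_mono) auto
      finally show ?thesis by simp
    qed
    then show ?case by blast
  next
    case (Suc n)
    have "norm (v' r x - u r x) \<le> 2 * R / 2 ^ Suc n * weight k r" if r: "r \<in> {r0..T}" for r x
    proof -
      have r': "r \<in> {0..T}" using r r0T by blast
      have "v' r x - u r x = future_integral (superposition u) r x - future_integral (superposition v') r x"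
        using v'fixed[OF r, of x] fixed[OF r', of x] by simp
      moreover have "norm (future_integral (superposition v') r x - future_integral (superposition u) r x)
          \<le> 2 * R / 2 ^ n / 2 * weight k r"
        by (rule superposition_contraction[OF k superposition_dominated[OF v'm v'R] superposition_dominated[OF um uR] v'R uR])
          (use Suc r r' R0 in auto)
      ultimately show ?thesis by (simp add: norm_minus_commute mult.commute)
    qed
    then show ?case by blast
  qed
  have "norm (v' r x - u r x) \<le> 2 * R * weight k r * (1 / 2) ^ n" for n
    using step[of n] r by (simp add: power_one_over field_simps)
  moreover have "(\<lambda>n. 2 * R * weight k r * (1 / 2) ^ n) \<longlonglongrightarrow> 2 * R * weight k r * 0"
    by (intro tendsto_mult tendsto_const LIMSEQ_power_zero) simp
  ultimately have "norm (v' r x - u r x) \<le> 2 * R * weight k r * 0"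
    by (intro LIMSEQ_le_const) auto
  then show ?thesis using r by (simp add: v'_def)
qed

lemma admissible_solution_bounded:
  assumes "admissible_solution T mu d M X P UNIV f g J v" "r0 \<in> J"
  obtains C where "\<And>r x. r \<in> {r0..T} \<Longrightarrow> norm (v r x) \<le> C"
proof -
  have "compact (closure ((\<lambda>(s, x). v s x) ` ({r0..T} \<times> UNIV)))"
    using assms unfolding admissible_solution_def Let_def by blast
  then have "bounded_on {r0..T} v" by (simp add: bounded_on_def)
  then show ?thesis using that by (rule bounded_onE)
qed

theorem picard_iteration:
  "\<exists>u. unique_nonextendible_solution T mu d M X P UNIV f g {0..T} u \<and>
    picard_integrals_exist T mu M X P f g \<and>
    (\<forall>n. borel_on d {0..T} UNIV (iterate n) \<and> bounded_on {0..T} (iterate n)) \<and>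
    uniform_limit ({0..T} \<times> UNIV) (\<lambda>n (r, x). iterate n r x) (\<lambda>(r, x). u r x) sequentially \<and>
    unique_global_bounded_solution T mu d M X P UNIV f g u"
proof -
  obtain u where um: "(\<lambda>(r, x). u r x) \<in> borel_measurable BTS"
    and ub: "\<And>r x. r \<in> {0..T} \<Longrightarrow> norm (u r x) \<le> radius"
    and ul: "uniform_limit ({0..T} \<times> UNIV) (\<lambda>n (r, x). iterate n r x) (\<lambda>(r, x). u r x) sequentially"
    and fixed: "\<And>r x. r \<in> {0..T} \<Longrightarrow> u r x = terminal_expectation g r x - future_integral (superposition u) r x"
    by (rule iterates_converge) blast
  have sol: "solution T mu d M X P UNIV f g {0..T} u"
    by (rule fixed_point_imp_solution[OF um ub fixed])
  have adm: "admissible_solution T mu d M X P UNIV f g {0..T} u"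
    unfolding admissible_solution_def Let_def
  proof (intro conjI ballI sol)
    fix r assume "r \<in> {0..T}"
    then have "bounded_on {r..T} u" by (intro bounded_onI[where C = radius] ub) auto
    then show "compact (closure ((\<lambda>(s, x). u s x) ` ({r..T} \<times> UNIV)))" by (simp add: bounded_on_def)
  qed simp
  \<comment> \<open>No admissible interval is larger than \<open>{0..T}\<close>.\<close>
  have nonext: "nonextendible_solution T mu d M X P UNIV f g {0..T} u"
    unfolding nonextendible_solution_def extendible_def
    using adm solution_interval[OF admissible_solution_imp_solution] by blast
  \<comment> \<open>Uniqueness is applied with \<open>r0 = r\<close>: an admissible solution is
    bounded on \<open>{r..T}\<close> for each \<open>r\<close> in \<open>J\<close>, though perhaps
    not on a half-open \<open>J\<close> as a whole.\<close>
  have eq: "v r x = u r x" if v: "admissible_solution T mu d M X P UNIV f g J v" and r: "r \<in> J" for J v r x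
  proof -
    note s = admissible_solution_imp_solution[OF v]
    have "r \<le> T" using r solution_interval[OF s] by auto
    obtain C where C: "\<And>s y. s \<in> {r..T} \<Longrightarrow> norm (v s y) \<le> C"
      using admissible_solution_bounded[OF v r] by blast
    show ?thesis
      by (rule bounded_solution_unique[OF um ub fixed s r C]) (use \<open>r \<le> T\<close> in auto)
  qed
  have "unique_nonextendible_solution T mu d M X P UNIV f g {0..T} u"
    unfolding unique_nonextendible_solution_def
  proof (intro conjI allI impI nonext)
    fix J v assume nv: "nonextendible_solution T mu d M X P UNIV f g J v"
    then have v: "admissible_solution T mu d M X P UNIV f g J v"
      and ne: "\<not> extendible T mu d M X P UNIV f g J v"
      unfolding nonextendible_solution_def by blast+
    have JT: "J \<subseteq> {0..T}"
      by (rule solution_interval[OF admissible_solution_imp_solution[OF v]])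
    show J: "J = {0..T}"
    proof (rule ccontr)
      \<comment> \<open>Otherwise \<open>u\<close> itself would extend \<open>v\<close>.\<close>
      assume "J \<noteq> {0..T}"
      then have "J \<subset> {0..T}" using JT by blast
      moreover have "\<forall>r\<in>J. \<forall>x. u r x = v r x" using eq[OF v] by simp
      ultimately show False using ne adm unfolding extendible_def by blast
    qed
    show "\<forall>r\<in>{0..T}. \<forall>x. v r x = u r x" using eq[OF v] J by blast
  qed
  moreover have "unique_global_bounded_solution T mu d M X P UNIV f g u"
    unfolding unique_global_bounded_solution_def
  proof (intro conjI allI impI ballI sol)
    show "bounded_on {0..T} u" by (rule bounded_onI[OF ub])
    fix v r x assume v: "solution T mu d M X P UNIV f g {0..T} v \<and> bounded_on {0..T} v" and r: "r \<in> {0..T}"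
    obtain C where C: "\<And>s y. s \<in> {0..T} \<Longrightarrow> norm (v s y) \<le> C"
      using v bounded_onE by blast
    show "v r x = u r x"
      by (rule bounded_solution_unique[OF um ub fixed conjunct1[OF v] _ C r]) (use T_pos in auto)
  qed
  moreover have "picard_integrals_exist T mu M X P f g"
    unfolding picard_integrals_exist_def
  proof (intro ballI allI conjI)
    fix r x n assume r: "r \<in> {0..T}"
    show "integrable (P r x) (\<lambda>\<omega>. g (X T \<omega>))" by (rule terminal_integrable[OF g_borel g_bound r])
    show "set_integrable mu {r..T} (\<lambda>s. f s (X s \<omega>) (iterate n s (X s \<omega>)))" if "\<omega> \<in> space M" for \<omega>
      by (rule path_set_integrable[OF iterate_dominated that Icc_borel, unfolded superposition_def])
    show "integrable (P r x) (\<lambda>\<omega>. LINT s:{r..T}|mu. f s (X s \<omega>) (iterate n s (X s \<omega>)))"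
      by (rule path_integral_integrable[OF iterate_dominated r r, unfolded superposition_def])
  qed
  moreover have "borel_on d {0..T} UNIV (iterate n) \<and> bounded_on {0..T} (iterate n)" for n
    using iterate_measurable[of n] bounded_onI[of "{0..T}" "iterate n" radius, OF iterate_bound]
    by (simp only: borel_on_UNIV simp_thms)
  ultimately show ?thesis using ul by blast
qed

end

theorem proposition2p10:
  fixes T :: real and mu :: "real measure"
    and d :: "real \<times> 's::topological_space \<Rightarrow> real \<times> 's \<Rightarrow> real"
    and M :: "'w measure" and X :: "real \<Rightarrow> 'w \<Rightarrow> 's" and F :: "real \<Rightarrow> 'w measure"
    and P :: "real \<Rightarrow> 's \<Rightarrow> 'w measure"
    and f :: "real \<Rightarrow> 's \<Rightarrow> real ^ 'k \<Rightarrow> real ^ 'k" and g :: "'s \<Rightarrow> real ^ 'k"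
  assumes "metrizable_space (euclidean :: 's topology)"
    and "separable_space (euclidean :: 's topology)"
    and "0 < T"
    and "sets mu = sets (restrict_space borel {0..T})" and "atomless mu"
    and "time_state_pseudometric T d"
    and "consistent_progressive_markov T d M X F P"
    and "f \<in> BC1minus T mu d UNIV"
    and "g \<in> borel_measurable borel" and "bounded (range g)" and "consistent_terminal T d g"
    and "affine_mu_bounded T mu d UNIV f"
  shows "\<exists>I_g u_g. unique_nonextendible_solution T mu d M X P UNIV f g I_g u_g \<and>
    I_g = {0..T} \<and>
    picard_integrals_exist T mu M X P f g \<and>
    (\<forall>n. borel_on d {0..T} UNIV (picard T mu X P f g n) \<and>
         bounded_on {0..T} (picard T mu X P f g n)) \<and>
    uniform_limit ({0..T} \<times> UNIV) (\<lambda>n (r, x). picard T mu X P f g n r x)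
      (\<lambda>(r, x). u_g r x) sequentially \<and>
    unique_global_bounded_solution T mu d M X P UNIV f g u_g"
proof -
  interpret atomless_time_measure T mu
    using assms(3-5) by (rule atomless_time_measure.intro)
  obtain h where h: "integrable mu h" "\<And>s. s \<in> {0..T} \<Longrightarrow> 0 \<le> h s"
    "AE s in mu. \<forall>y w. norm (f s y w) \<le> h s * (1 + norm w)"
    using affine_mu_boundedE[OF assms(12)] by blast
  obtain G where G: "\<And>x. norm (g x) \<le> G" using assms(10) unfolding bounded_iff by blast
  \<comment> \<open>Metrizability and separability of the state space enter through second
    countability.\<close>
  have "progressive_markov_pseudometric T d M X F P"
    by (intro progressive_markov_pseudometric.intro progressive_markov_pseudometric_axioms.intro
        separable_metrizable_imp_second_countable assms(1,2,6,7))
  then have "markov_time_integral T d M X F P mu"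
    using atomless_time_measure_axioms by (rule markov_time_integral.intro)
  moreover have "jointly_borel T d UNIV f" "locally_Lipschitz_mu_continuous T mu d UNIV f"
    using assms(8) by (simp_all add: BC1minus_def)
  ultimately interpret markov_integral_problem T d M X F P mu f g G h
    using assms(9,11) h G
    by (intro markov_integral_problem.intro markov_integral_problem_axioms.intro)
  show ?thesis using picard_iteration by blast
qed

end
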